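(* For any coprime positive integers $m,n$ and any integer $k\ge1$, $$q^{(km-1)(kn-1)/2+(k-1)/2}\;Q^s_{km,kn}\,(-1)^{kn}\;=\;\frac{[k]_q}{[km]_q}\,e_{kn}\big[X[km]_q\big],$$ where $Q^s_{km,kn}$ is applied to the constant symmetric function $(-1)^{kn}$.
   Context: Let $\Lambda$ be the ring of symmetric functions in the infinite alphabet $X=x_1+x_2+\cdots$ with coefficients in $\mathbb{Q}(q)$. Plethystic notation: for a formal expression $E$, $p_k[E]$ is obtained from $E$ by replacing every variable (including $q$ and an auxiliary variable $z$) by its $k$-th power; for $F\in\Lambda$, $F[E]$ is obtained by writing $F$ in power sums and substituting $p_k\mapsto p_k[E]$ (so $e_{kn}[X[km]_q]$ is $e_{kn}$ evaluated at the alphabet $\{q^jx_i: 0\le j\le km-1,\ i\ge1\}$). Set $\Omega[E]=\exp(\sum_{k\ge1}p_k[E]/k)$. For an integer $u$ put $[u]_q=(1-q^u)/(1-q)$; set $t=1/q$, $[u]_t=(1-q^{-u})/(1-q^{-1})$, $M=(1-t)(1-q)$. For integers $u,v$ let $D_{u,v}F[X]=F[X+M[u]_q/z]\,\Omega[-z[u]_tX]\big|_{z^v}$. With $[A,B]=AB-BA$: for coprime positive $m,n$, $Q^s_{1,n}=D_{1,n}$ (also $Q^s_{1,0}=D_{1,0}$); if $m\ge2$, with $(a,b)$ the unique integer pair with $1\le a\le m-1$ and $na-mb=1$, $Q^s_{m,n}=\frac1M[Q^s_{m-a,n-b},Q^s_{a,b}]$. For $k\ge2$ and coprime positive $m,n$,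 $Q^s_{km,kn}=\frac1M[Q^s_{km-a,kn-b},Q^s_{a,b}]$ for any integer pair $(a,b)$ with $1\le a\le km-1$ and $na-mb=1$ (independent of the choice). These are the specializations at $t=1/q$ of the Burban–Schiffmann operators $Q_{m,n}$. *)

theory Defs
  imports
    "HOL-Library.Poly_Mapping"
    "HOL-Library.Multiset"
    "HOL-Computational_Algebra.Computational_Algebra"
    "HOL-Computational_Algebra.Field_as_Ring"
begin

section \<open>The ring of symmetric functions\<close>

text \<open>
  A monomial in the variables \<open>x\<^sub>0, x\<^sub>1, x\<^sub>2, \<dots>\<close> is a finite multiset of indices.  A symmetric
  function is a formal series of bounded degree, given by its coefficients, that is invariant
  under all permutations of the variables.
\<close>

definition sym_series :: "(nat multiset \<Rightarrow> 'a::zero) set" where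
  "sym_series = {F. (\<forall>\<sigma>. bij \<sigma> \<longrightarrow> (\<forall>m. F (image_mset \<sigma> m) = F m)) \<and>
                    (\<exists>d. \<forall>m. d < size m \<longrightarrow> F m = 0)}"

lemma sym_seriesI:
  assumes "\<And>\<sigma> m. bij \<sigma> \<Longrightarrow> F (image_mset \<sigma> m) = F m" "\<And>m. d < size m \<Longrightarrow> F m = 0"
  shows "F \<in> sym_series"
  using assms by (auto simp: sym_series_def)

lemma sym_series_image_mset: "F \<in> sym_series \<Longrightarrow> bij \<sigma> \<Longrightarrow> F (image_mset \<sigma> m) = F m"
  by (simp add: sym_series_def)

lemma sym_series_bounded:
  assumes "F \<in> sym_series"
  obtains d where "\<And>m. d < size m \<Longrightarrow> F m = 0"
  using assms by (auto simp: sym_series_def)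

typedef (overloaded) 'a symfun = "sym_series :: (nat multiset \<Rightarrow> 'a::comm_ring_1) set"
  morphisms coeff_sf Abs_symfun
  by (rule exI[of _ "\<lambda>_. 0"]) (simp add: sym_series_def)

setup_lifting type_definition_symfun

lemma image_mset_bij:
  assumes "bij \<sigma>"
  shows "image_mset (inv \<sigma>) (image_mset \<sigma> m) = m" "image_mset \<sigma> (image_mset (inv \<sigma>) m') = m'"
  using assms by (simp_all add: multiset.map_comp bij_is_inj bij_is_surj surj_iff[THEN iffD1])

lemma finite_submultisets: "finite {a. a \<subseteq># (m :: 'b multiset)}"
proof (induction m)
  case empty
  then show ?case by simp
next
  case (add x m)
  have "{a. a \<subseteq># add_mset x m} \<subseteq> {a. a \<subseteq># m} \<union> add_mset x ` {a. a \<subseteq># m}"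
  proof
    fix a assume a: "a \<in> {a. a \<subseteq># add_mset x m}"
    show "a \<in> {a. a \<subseteq># m} \<union> add_mset x ` {a. a \<subseteq># m}"
    proof (cases "x \<in># a")
      case True
      then obtain b where "a = add_mset x b" by (metis insert_DiffM)
      with a show ?thesis by auto
    next
      case False
      have "a \<subseteq># m"
      proof (rule mset_subset_eqI)
        fix y show "count a y \<le> count m y"
          using mset_subset_eq_count[of a "add_mset x m" y] a False
          by (cases "y = x") (auto simp: not_in_iff)
      qed
      then show ?thesis by simp
    qed
  qed
  then show ?case using add.IH by (meson finite_UnI finite_imageI finite_subset)
qed

lemma submultisets_image_bij:
  assumes "bij \<sigma>"
  shows "{a. a \<subseteq># image_mset \<sigma> m} = image_mset \<sigma> ` {a. a \<subseteq># m}"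
proof (intro equalityI subsetI)
  fix a assume "a \<in> {a. a \<subseteq># image_mset \<sigma> m}"
  then have "image_mset (inv \<sigma>) a \<subseteq># image_mset (inv \<sigma>) (image_mset \<sigma> m)"
    by (auto intro: image_mset_subseteq_mono)
  also have "image_mset (inv \<sigma>) (image_mset \<sigma> m) = m"
    by (rule image_mset_bij[OF assms])
  finally have 1: "image_mset (inv \<sigma>) a \<subseteq># m" .
  have "image_mset \<sigma> (image_mset (inv \<sigma>) a) = a"
    by (rule image_mset_bij[OF assms])
  with 1 show "a \<in> image_mset \<sigma> ` {a. a \<subseteq># m}" by (metis image_eqI mem_Collect_eq)
next
  fix a assume "a \<in> image_mset \<sigma> ` {a. a \<subseteq># m}"
  then show "a \<in> {a. a \<subseteq># image_mset \<sigma> m}" by (auto intro: image_mset_subseteq_mono)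
qed

instantiation symfun :: (comm_ring_1) comm_ring_1
begin

lift_definition zero_symfun :: "'a symfun" is "\<lambda>_. 0"
  by (auto simp: sym_series_def)

lift_definition one_symfun :: "'a symfun" is "\<lambda>m. if m = {#} then 1 else 0"
  by (auto simp: sym_series_def)

lift_definition plus_symfun :: "'a symfun \<Rightarrow> 'a symfun \<Rightarrow> 'a symfun" is "\<lambda>F G m. F m + G m"
proof -
  fix F G :: "nat multiset \<Rightarrow> 'a"
  assume F: "F \<in> sym_series"
    and G: "G \<in> sym_series"
  from F obtain d where d: "\<And>m. d < size m \<Longrightarrow> F m = 0" using sym_series_bounded by metis
  from G obtain e where e: "\<And>m. e < size m \<Longrightarrow> G m = 0" using sym_series_bounded by metis
  show "(\<lambda>m. F m + G m) \<in> sym_series"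
  proof (rule sym_seriesI)
    show "F m + G m = 0" if "max d e < size m" for m using that d e by simp
  qed (use F G in \<open>simp add: sym_series_image_mset\<close>)
qed

lift_definition uminus_symfun :: "'a symfun \<Rightarrow> 'a symfun" is "\<lambda>F m. - F m"
  by (auto simp: sym_series_def)

definition minus_symfun :: "'a symfun \<Rightarrow> 'a symfun \<Rightarrow> 'a symfun"
  where "minus_symfun F G = F + (- G)"

lift_definition times_symfun :: "'a symfun \<Rightarrow> 'a symfun \<Rightarrow> 'a symfun"
  is "\<lambda>F G m. \<Sum>a | a \<subseteq># m. F a * G (m - a)"
proof -
  fix F G :: "nat multiset \<Rightarrow> 'a"
  assume F: "F \<in> sym_series"
    and G: "G \<in> sym_series"
  from F obtain d where d: "\<And>m. d < size m \<Longrightarrow> F m = 0" using sym_series_bounded by metis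
  from G obtain e where e: "\<And>m. e < size m \<Longrightarrow> G m = 0" using sym_series_bounded by metis
  have bdd: "(\<Sum>a | a \<subseteq># m. F a * G (m - a)) = 0" if "d + e < size m" for m
  proof (rule sum.neutral, rule ballI)
    fix a assume "a \<in> {a. a \<subseteq># m}"
    then have "size m = size a + size (m - a)"
      by (metis mem_Collect_eq size_union subset_mset.add_diff_inverse)
    with that have "d < size a \<or> e < size (m - a)" by linarith
    then show "F a * G (m - a) = 0" using d e by auto
  qed
  have sym: "(\<Sum>a | a \<subseteq># image_mset \<sigma> m. F a * G (image_mset \<sigma> m - a)) =
      (\<Sum>a | a \<subseteq># m. F a * G (m - a))" if \<sigma>: "bij \<sigma>" for \<sigma> m
  proof -
    have inj: "inj_on (image_mset \<sigma>) {a. a \<subseteq># m}"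
      by (rule inj_on_inverseI[of _ "image_mset (inv \<sigma>)"]) (rule image_mset_bij[OF \<sigma>])
    have "(\<Sum>a | a \<subseteq># image_mset \<sigma> m. F a * G (image_mset \<sigma> m - a)) =
        (\<Sum>a | a \<subseteq># m. F (image_mset \<sigma> a) * G (image_mset \<sigma> m - image_mset \<sigma> a))"
      unfolding submultisets_image_bij[OF \<sigma>] by (simp add: sum.reindex[OF inj])
    also have "\<dots> = (\<Sum>a | a \<subseteq># m. F a * G (m - a))"
    proof (rule sum.cong[OF refl])
      fix a assume "a \<in> {a. a \<subseteq># m}"
      then have "image_mset \<sigma> m - image_mset \<sigma> a = image_mset \<sigma> (m - a)"
        by (simp add: image_mset_Diff)
      then show "F (image_mset \<sigma> a) * G (image_mset \<sigma> m - image_mset \<sigma> a) = F a * G (m - a)"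
        using F G \<sigma> by (simp add: sym_series_image_mset)
    qed
    finally show ?thesis .
  qed
  from sym bdd show "(\<lambda>m. \<Sum>a | a \<subseteq># m. F a * G (m - a)) \<in> sym_series"
    by (rule sym_seriesI)
qed

instance
proof
  fix F G H :: "'a symfun"
  show "F + G + H = F + (G + H)" by transfer (simp add: add.assoc)
  show "F + G = G + F" by transfer (simp add: add.commute)
  show "0 + F = F" by transfer simp
  show "- F + F = 0" by transfer simp
  show "F - G = F + - G" by (rule minus_symfun_def)
  show "(0::'a symfun) \<noteq> 1" by transfer (auto dest: fun_cong[of _ _ "{#}"])
  show "(F + G) * H = F * H + G * H" by transfer (simp add: distrib_right sum.distrib)
  show "1 * F = F"
  proof (transfer, rule ext)
    fix F :: "nat multiset \<Rightarrow> 'a" and m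
    have "(\<Sum>a | a \<subseteq># m. (if a = {#} then 1 else 0) * F (m - a)) =
        (\<Sum>a | a \<subseteq># m. if a = {#} then F m else 0)"
      by (rule sum.cong) auto
    then show "(\<Sum>a | a \<subseteq># m. (if a = {#} then 1 else 0) * F (m - a)) = F m"
      by (simp add: finite_submultisets)
  qed
  show "F * G = G * F"
  proof (transfer, rule ext)
    fix F G :: "nat multiset \<Rightarrow> 'a" and m
    show "(\<Sum>a | a \<subseteq># m. F a * G (m - a)) = (\<Sum>a | a \<subseteq># m. G a * F (m - a))"
      by (rule sum.reindex_bij_witness[of _ "\<lambda>a. m - a" "\<lambda>a. m - a"])
        (auto simp: subset_mset.diff_diff_right double_diff mult.commute)
  qed
  show "F * G * H = F * (G * H)"
  proof (transfer, rule ext)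
    fix F G H :: "nat multiset \<Rightarrow> 'a" and m
    have "(\<Sum>a | a \<subseteq># m. (\<Sum>b | b \<subseteq># a. F b * G (a - b)) * H (m - a)) =
        (\<Sum>(a, b)\<in>(SIGMA a:{a. a \<subseteq># m}. {b. b \<subseteq># a}). F b * G (a - b) * H (m - a))"
      by (simp add: sum_distrib_right sum.Sigma finite_submultisets)
    also have "\<dots> = (\<Sum>(b, c)\<in>(SIGMA b:{b. b \<subseteq># m}. {c. c \<subseteq># m - b}). F b * (G c * H (m - b - c)))"
    proof (rule sum.reindex_bij_witness[of _ "\<lambda>(b, c). (b + c, b)" "\<lambda>(a, b). (b, a - b)"])
      fix p assume "p \<in> (SIGMA a:{a. a \<subseteq># m}. {b. b \<subseteq># a})"
      then obtain a b where p: "p = (a, b)" "a \<subseteq># m" "b \<subseteq># a" by auto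
      obtain c where c: "a = b + c" using p(3) by (auto simp: mset_subset_eq_exists_conv)
      obtain d where d: "m = b + c + d" using p(2) c by (auto simp: mset_subset_eq_exists_conv)
      show "(case case p of (a, b) \<Rightarrow> (b, a - b) of (b, c) \<Rightarrow> (b + c, b)) = p"
        by (simp add: p(1) c)
      show "(case p of (a, b) \<Rightarrow> (b, a - b)) \<in> (SIGMA b:{b. b \<subseteq># m}. {c. c \<subseteq># m - b})"
        by (simp add: p(1) c d add.assoc)
      show "(case case p of (a, b) \<Rightarrow> (b, a - b) of (b, c) \<Rightarrow> F b * (G c * H (m - b - c))) =
          (case p of (a, b) \<Rightarrow> F b * G (a - b) * H (m - a))"
        by (simp add: p(1) c d mult.assoc)
    next
      fix p assume "p \<in> (SIGMA b:{b. b \<subseteq># m}. {c. c \<subseteq># m - b})"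
      then obtain b c where p: "p = (b, c)" "b \<subseteq># m" "c \<subseteq># m - b" by auto
      obtain d where d: "m = b + d" using p(2) by (auto simp: mset_subset_eq_exists_conv)
      obtain e where e: "d = c + e" using p(3) d by (auto simp: mset_subset_eq_exists_conv)
      show "(case case p of (b, c) \<Rightarrow> (b + c, b) of (a, b) \<Rightarrow> (b, a - b)) = p"
        by (simp add: p(1))
      show "(case p of (b, c) \<Rightarrow> (b + c, b)) \<in> (SIGMA a:{a. a \<subseteq># m}. {b. b \<subseteq># a})"
        by (simp add: p(1) d e add.assoc)
    qed
    also have "\<dots> = (\<Sum>a | a \<subseteq># m. F a * (\<Sum>b | b \<subseteq># m - a. G b * H (m - a - b)))"
      by (simp add: sum_distrib_left sum.Sigma finite_submultisets)
    finally show "(\<Sum>a | a \<subseteq># m. (\<Sum>b | b \<subseteq># a. F b * G (a - b)) * H (m - a)) =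
        (\<Sum>a | a \<subseteq># m. F a * (\<Sum>b | b \<subseteq># m - a. G b * H (m - a - b)))" .
  qed
qed

end

lift_definition const_sf :: "'a::comm_ring_1 \<Rightarrow> 'a symfun" is "\<lambda>c m. if m = {#} then c else 0"
  by (auto simp: sym_series_def)

lift_definition power_sum :: "nat \<Rightarrow> 'a::comm_ring_1 symfun"
  is "\<lambda>k m. if \<exists>i. m = replicate_mset k i then 1 else 0"
proof -
  fix k
  have "(\<exists>i. image_mset \<sigma> m = replicate_mset k i) \<longleftrightarrow> (\<exists>i. m = replicate_mset k i)"
    if \<sigma>: "bij \<sigma>" for \<sigma> :: "nat \<Rightarrow> nat" and m
  proof
    assume "\<exists>i. image_mset \<sigma> m = replicate_mset k i"
    then obtain i where "image_mset \<sigma> m = replicate_mset k i" by blast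
    then have "m = replicate_mset k (inv \<sigma> i)"
      using image_mset_bij(1)[OF \<sigma>, of m] by simp
    then show "\<exists>i. m = replicate_mset k i" by blast
  qed auto
  then show "(\<lambda>m. if \<exists>i. m = replicate_mset k i then 1 else 0 :: 'a) \<in> sym_series"
    by (intro sym_seriesI[of _ k]) auto
qed

lift_definition elem_sym :: "nat \<Rightarrow> 'a::comm_ring_1 symfun"
  is "\<lambda>n m. if size m = n \<and> (\<forall>i. count m i \<le> 1) then 1 else 0"
proof -
  fix n
  have "(\<forall>i. count (image_mset \<sigma> m) i \<le> 1) \<longleftrightarrow> (\<forall>i. count m i \<le> 1)"
    if \<sigma>: "bij \<sigma>" for \<sigma> :: "nat \<Rightarrow> nat" and m
  proof -
    have "count (image_mset \<sigma> m) (\<sigma> i) = count m i" for i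
      using bij_is_inj[OF \<sigma>] by (induction m) (auto simp: inj_eq)
    moreover have "\<exists>i. j = \<sigma> i" for j
      using \<sigma> by (metis bij_is_surj surj_def)
    ultimately show ?thesis by metis
  qed
  then show "(\<lambda>m. if size m = n \<and> (\<forall>i. count m i \<le> 1) then 1 else 0 :: 'a) \<in> sym_series"
    by (intro sym_seriesI[of _ n]) simp_all
qed


section \<open>Plethystic substitution\<close>

type_synonym Qq = "rat poly fract"

definition q :: Qq where "q = to_fract [:0, 1:]"

definition t :: Qq where "t = 1 / q"

text \<open>The endomorphism of the field \<open>\<rat>(q)\<close> that sends \<open>q\<close> to its \<open>k\<close>-th power (\<open>k > 0\<close>).\<close>

definition frob_q :: "nat \<Rightarrow> Qq \<Rightarrow> Qq" where
  "frob_q k r = (let (a, b) = quot_of_fract r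
                 in Fract (pcompose a (monom 1 k)) (pcompose b (monom 1 k)))"

lemma frob_q_0 [simp]: "frob_q k 0 = 0"
  by (simp add: frob_q_def fract_collapse)

text \<open>
  For \<open>k > 0\<close> the sum below has at most one term: the coefficient of a monomial \<open>m\<close> is nonzero
  only if \<open>m\<close> is the \<open>k\<close>-th power of a monomial \<open>a\<close>.
\<close>

lift_definition frob_sf :: "nat \<Rightarrow> Qq symfun \<Rightarrow> Qq symfun"
  is "\<lambda>k F m. \<Sum>a | repeat_mset k a = m. frob_q k (F a)"
proof -
  fix k and F :: "nat multiset \<Rightarrow> Qq"
  assume F: "F \<in> sym_series"
  then obtain d where d: "\<And>m. d < size m \<Longrightarrow> F m = 0" using sym_series_bounded by metis
  have bdd: "(\<Sum>a | repeat_mset k a = m. frob_q k (F a)) = 0" if "k * d < size m" for m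
  proof (rule sum.neutral, rule ballI)
    fix a assume "a \<in> {a. repeat_mset k a = m}"
    with that have "k * d < k * size a" by auto
    then show "frob_q k (F a) = 0" using d by simp
  qed
  have sym: "(\<Sum>a | repeat_mset k a = image_mset \<sigma> m. frob_q k (F a)) =
      (\<Sum>a | repeat_mset k a = m. frob_q k (F a))" if \<sigma>: "bij \<sigma>" for \<sigma> m
  proof -
    have rep: "repeat_mset k (image_mset \<tau> a) = image_mset \<tau> (repeat_mset k a)"
      for \<tau> :: "nat \<Rightarrow> nat" and a by (induction k) simp_all
    have 3: "F (image_mset (inv \<sigma>) a) = F a" for a
      using F \<sigma> by (simp add: sym_series_image_mset bij_imp_bij_inv)
    show ?thesis
      by (rule sum.reindex_bij_witness[of _ "image_mset \<sigma>" "image_mset (inv \<sigma>)"])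
        (auto simp: rep 3 image_mset_bij[OF \<sigma>])
  qed
  from sym bdd show "(\<lambda>m. \<Sum>a | repeat_mset k a = m. frob_q k (F a)) \<in> sym_series"
    by (rule sym_seriesI)
qed

lemma frob_sf_0 [simp]: "frob_sf k 0 = 0"
  by transfer simp

text \<open>
  Plethystic expressions are Laurent series in \<open>z\<close> (the generator \<^const>\<open>fls_X\<close>) whose coefficients
  are symmetric functions over \<open>\<rat>(q)\<close>.  The following is \<open>p\<^sub>k[E]\<close> (for \<open>k > 0\<close>): it raises
  \<open>z\<close>, \<open>q\<close> and all the \<open>x\<^sub>i\<close> to their \<open>k\<close>-th powers, and leaves rational numbers, hence signs, alone.
\<close>

lift_definition power_sum_pleth :: "nat \<Rightarrow> Qq symfun fls \<Rightarrow> Qq symfun fls"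
  is "\<lambda>k E j. frob_sf k (fls_nth (fls_compose_power E k) j)"
proof -
  fix k and E :: "Qq symfun fls"
  have "\<forall>\<^sub>\<infinity>n. fls_nth (fls_compose_power E k) (- int n) = 0"
    using fls_nth[of "fls_compose_power E k"] by simp
  then show "\<forall>\<^sub>\<infinity>n. frob_sf k (fls_nth (fls_compose_power E k) (- int n)) = 0"
    by (rule MOST_mono) simp
qed

abbreviation cst :: "Qq \<Rightarrow> Qq symfun fls" where
  "cst c \<equiv> fls_const (const_sf c)"

text \<open>
  A partition is encoded as a multiset of positive integers, and \<open>p\<^sub>\<mu>\<close> is the product of the
  \<open>p\<^sub>k\<close> over its parts.
\<close>

definition power_sum_expansion :: "(nat multiset \<Rightarrow>\<^sub>0 Qq) \<Rightarrow> Qq symfun \<Rightarrow> bool" where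
  "power_sum_expansion c F \<longleftrightarrow>
     (\<forall>\<mu>\<in>Poly_Mapping.keys c. 0 \<notin># \<mu>) \<and>
     F = (\<Sum>\<mu>\<in>Poly_Mapping.keys c. const_sf (Poly_Mapping.lookup c \<mu>) * (\<Prod>k\<in>#\<mu>. power_sum k))"

text \<open>
  The expansion of \<open>F\<close> in power sums exists and is unique, since the \<open>p\<^sub>\<mu>\<close> form a basis of the
  symmetric functions over a field of characteristic \<open>0\<close>.  Its coefficients are not
  affected by the substitution.
\<close>

definition pleth :: "Qq symfun \<Rightarrow> Qq symfun fls \<Rightarrow> Qq symfun fls" where
  "pleth F E = (let c = (THE c. power_sum_expansion c F)
     in \<Sum>\<mu>\<in>Poly_Mapping.keys c.
          cst (Poly_Mapping.lookup c \<mu>) * (\<Prod>k\<in>#\<mu>. power_sum_pleth k E))"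

text \<open>
  \<open>\<Omega>[E]\<close>, for \<open>E\<close> divisible by \<open>z\<close>.  Then \<open>p\<^sub>k[E]\<close> is divisible by the \<open>k\<close>-th power of \<open>z\<close>, and
  so is the \<open>k\<close>-th power of \<open>log \<Omega>[E]\<close>; hence only the indices up to \<open>n\<close> contribute to the
  coefficient at the \<open>n\<close>-th power of \<open>z\<close>, both in the sum of the \<open>p\<^sub>k[E] / k\<close> and in the
  exponential series.
\<close>

definition log_Omega :: "Qq symfun fls \<Rightarrow> Qq symfun fps" where
  "log_Omega E = Abs_fps (\<lambda>n. \<Sum>k=1..n. const_sf (1 / of_nat k) * fls_nth (power_sum_pleth k E) (int n))"

definition Omega :: "Qq symfun fls \<Rightarrow> Qq symfun fls" where
  "Omega E = fps_to_fls (Abs_fps (\<lambda>n. \<Sum>j\<le>n. const_sf (1 / fact j) * fps_nth (log_Omega E ^ j) n))"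


section \<open>The operators\<close>

definition qint :: "Qq \<Rightarrow> int \<Rightarrow> Qq" where
  "qint x u = (1 - x powi u) / (1 - x)"

definition M :: Qq where "M = (1 - t) * (1 - q)"

abbreviation X :: "Qq symfun fls" where "X \<equiv> fls_const (power_sum 1)"

definition D :: "int \<Rightarrow> int \<Rightarrow> Qq symfun \<Rightarrow> Qq symfun" where
  "D u v F = fls_nth (pleth F (X + cst (M * qint q u) * fls_X_inv) *
                      Omega (- (fls_X * cst (qint t u) * X))) v"

text \<open>
  \<open>is_Qs r v T\<close> says that \<open>T\<close> is an operator \<open>Q\<^sup>s\<^bsub>r,v\<^esub>\<close>.  In the second rule \<open>k = 1\<close> is the
  recursion for coprime \<open>(m, n)\<close>, where \<open>m \<ge> 2\<close> is forced and \<open>(a, b)\<close> is unique; for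
  \<open>k \<ge> 2\<close> every admissible pair \<open>(a, b)\<close> is allowed.  The index pairs \<open>(a, b)\<close> and
  \<open>(k m - a, k n - b)\<close> are again coprime, and the only one with second entry \<open>0\<close> is \<open>(1, 0)\<close>.
\<close>

inductive is_Qs :: "int \<Rightarrow> int \<Rightarrow> (Qq symfun \<Rightarrow> Qq symfun) \<Rightarrow> bool" where
  base: "n \<ge> 0 \<Longrightarrow> is_Qs 1 n (D 1 n)"
| step: "is_Qs (k * m) (k * n) (\<lambda>F. const_sf (1 / M) * (A (B F) - B (A F)))"
  if "k \<ge> 1" "m \<ge> 1" "n \<ge> 1" "coprime m n"
    "1 \<le> a" "a \<le> k * m - 1" "n * a - m * b = 1"
    "is_Qs (k * m - a) (k * n - b) A" "is_Qs a b B"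

lemma Qs_indices:
  fixes k m n a b :: int
  assumes "k \<ge> 1" "m \<ge> 1" "n \<ge> 1" "1 \<le> a" "a \<le> k * m - 1" "n * a - m * b = 1"
  shows "coprime a b" "b \<ge> 0" "b = 0 \<longrightarrow> a = 1" "coprime (k * m - a) (k * n - b)" "k * n - b \<ge> 1"
proof -
  show "coprime a b"
  proof (rule coprimeI)
    fix d assume "d dvd a" "d dvd b"
    then have "d dvd n * a - m * b" by simp
    with assms(6) show "is_unit d" by simp
  qed
  have "n * a \<ge> 1" using assms by (simp add: mult_le_cancel_left1 int_one_le_iff_zero_less)
  then have "m * b \<ge> 0" using assms(6) by linarith
  with assms(2) show "b \<ge> 0" by (simp add: zero_le_mult_iff)
  show "b = 0 \<longrightarrow> a = 1" using assms(3,4,6) by (auto simp: zmult_eq_1_iff)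
  have eq: "m * (k * n - b) - n * (k * m - a) = 1" using assms(6) by (simp add: algebra_simps)
  show "coprime (k * m - a) (k * n - b)"
  proof (rule coprimeI)
    fix d assume "d dvd k * m - a" "d dvd k * n - b"
    then have "d dvd m * (k * n - b) - n * (k * m - a)" by simp
    with eq show "is_unit d" by simp
  qed
  have "n * (k * m - a) \<ge> 0" using assms by simp
  with eq have "m * (k * n - b) > 0" by linarith
  with assms(2) show "k * n - b \<ge> 1" by (simp add: zero_less_mult_iff)
qed

lemma Qs_pair_exists:
  fixes k m n :: int
  assumes "k \<ge> 1" "m \<ge> 1" "coprime m n" "k * m \<ge> 2"
  obtains a b where "1 \<le> a" "a \<le> k * m - 1" "n * a - m * b = 1"
proof (cases "m = 1")
  case True
  with assms that[of 1 "n - 1"] show ?thesis by simp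
next
  case False
  with assms have m: "m \<ge> 2" by simp
  from assms(3) obtain x y where xy: "x * m + y * n = 1"
    using bezout_int[of m n] by (auto simp: coprime_iff_gcd_eq_1)
  define a where "a = y mod m"
  have a: "0 \<le> a" "a < m" using m by (auto simp: a_def)
  have y: "y = m * (y div m) + a" by (simp add: a_def)
  have eq: "n * a - m * (- x - n * (y div m)) = 1"
    using xy by (subst (asm) y) (simp add: algebra_simps)
  have "a \<noteq> 0"
  proof
    assume "a = 0"
    with eq have "m dvd 1" by (metis dvd_triv_left mult_zero_right diff_0 mult_minus_right)
    with m show False by simp
  qed
  moreover have "m \<le> k * m" using assms(1) m by simp
  ultimately show ?thesis using that[OF _ _ eq] a by linarith
qed

lemma is_Qs_coprime_exists:
  fixes m n :: int
  assumes "m \<ge> 1" "n \<ge> 0" "n = 0 \<longrightarrow> m = 1" "coprime m n"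
  shows "\<exists>T. is_Qs m n T"
  using assms
proof (induction "nat m" arbitrary: m n rule: less_induct)
  case less
  show ?case
  proof (cases "m = 1")
    case True
    with less.prems show ?thesis by (blast intro: is_Qs.base)
  next
    case False
    with less.prems have mn: "1 * m \<ge> 2" "n \<ge> 1" by auto
    obtain a b where ab: "1 \<le> a" "a \<le> 1 * m - 1" "n * a - m * b = 1"
      using Qs_pair_exists[of 1 m n] less.prems mn by auto
    note idx = Qs_indices[OF order_refl less.prems(1) mn(2) ab]
    obtain A where "is_Qs (1 * m - a) (1 * n - b) A"
      using less.hyps[of "1 * m - a" "1 * n - b"] idx ab by auto
    moreover obtain B where "is_Qs a b B"
      using less.hyps[of a b] idx ab by auto
    ultimately have "is_Qs (1 * m) (1 * n) (\<lambda>F. const_sf (1 / M) * (A (B F) - B (A F)))"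
      using less.prems mn ab by (intro is_Qs.step) auto
    then show ?thesis by auto
  qed
qed

lemma is_Qs_exists:
  fixes k m n :: int
  assumes "k \<ge> 1" "m \<ge> 1" "n \<ge> 1" "coprime m n"
  shows "\<exists>T. is_Qs (k * m) (k * n) T"
proof (cases "k * m = 1")
  case True
  with assms have "k = 1" "m = 1" by (auto simp: zmult_eq_1_iff)
  with assms show ?thesis by (auto intro!: exI is_Qs.base)
next
  case False
  moreover have "k * m \<ge> 1" using assms by (simp add: int_one_le_iff_zero_less)
  ultimately have "k * m \<ge> 2" by linarith
  then obtain a b where ab: "1 \<le> a" "a \<le> k * m - 1" "n * a - m * b = 1"
    using Qs_pair_exists assms by blast
  note idx = Qs_indices[OF assms(1-3) ab]
  obtain A where "is_Qs (k * m - a) (k * n - b) A"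
    using is_Qs_coprime_exists[of "k * m - a" "k * n - b"] idx ab by auto
  moreover obtain B where "is_Qs a b B"
    using is_Qs_coprime_exists[of a b] idx ab by auto
  ultimately show ?thesis using assms ab by (blast intro: is_Qs.step)
qed

text \<open>This makes the exponent of \<open>q\<close> in \<open>(k m - 1)(k n - 1)/2 + (k - 1)/2\<close> an integer.\<close>

lemma Qs_exponent_even:
  fixes k m n :: nat
  assumes "k \<ge> 1" "m \<ge> 1" "n \<ge> 1" "coprime m n"
  shows "even ((k * m - 1) * (k * n - 1) + (k - 1))"
proof -
  have "odd m \<or> odd n" using assms(4) by (meson coprime_common_divisor_nat coprime_def odd_one)
  with assms show ?thesis by auto
qed

end

theory Submission
  imports Defs
begin

text \<open>
  For \<open>t = 1/q\<close> the operators \<open>D\<^bsub>u,v\<^esub>\<close> close under commutators: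
  \<open>[D\<^bsub>u,b\<^esub>, D\<^bsub>w,d\<^esub>] = C\<^bsub>u,w\<^esub> (q\<^sup>u\<^sup>d - q\<^sup>w\<^sup>b) D\<^bsub>u+w,b+d\<^esub>\<close> with
  \<open>C\<^bsub>u,w\<^esub> = (1 - q\<^sup>-\<^sup>u) (1 - q\<^sup>-\<^sup>w) / (1 - q\<^sup>-\<^sup>u\<^sup>-\<^sup>w)\<close>.  It follows inductively that
  \<open>Q\<^sup>s\<^bsub>km,kn\<^esub>\<close> is the multiple of \<open>D\<^bsub>km,kn\<^esub>\<close> by \<open>[k]\<^sub>q q\<^sup>e / [km]\<^sub>t\<close>, where
  \<open>2 e = (km - 1) (kn - 1) - (k - 1)\<close>.  On constants \<open>D\<^bsub>u,v\<^esub>\<close> is multiplication by the coefficient of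
  \<open>z\<^sup>v\<close> in \<open>\<Omega>[- z [u]\<^sub>t X]\<close>, that is, by \<open>(-1)\<^sup>v e\<^sub>v[X [u]\<^sub>t]\<close>, and \<open>[u]\<^sub>t = q\<^sup>1\<^sup>-\<^sup>u [u]\<^sub>q\<close>.
\<close>

section \<open>Power sums\<close>

text \<open>The definite description in \<open>pleth\<close> yields nothing until an expansion in
  power sums is exhibited and known to be unique. All computations are therefore made on
  \<open>psum_polys\<close>, the functions that possess an expansion: linear independence of the
  products of the p_k makes \<open>pleth\<close> a ring homomorphism there, the set contains the
  constants and the e_n, and every D_{u,v} maps it to itself. Infinite products and exponentials are
  compared through logarithmic derivatives. A series with constant term 1 is determined by its
  Newton recursion as soon as the positive integers are invertible, so identities between series
  \<Omega>[E] become identities between the scalars multiplying p_k. The commutators close because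
  p_k[M[u]_q[w]_t] = (1 - q^(uk)) (1 - q^(-wk)) has just four terms: the factor produced by
  exchanging two operators is a rational function with two simple poles, and its expansion
  coefficients for (u,w) and for (w,u) are, up to sign, two halves of a single sequence indexed by
  the integers.\<close>

lemma symfun_eqI: "(\<And>m. coeff_sf F m = coeff_sf G m) \<Longrightarrow> F = G"
  by (simp add: coeff_sf_inject[symmetric] fun_eq_iff)

lemma const_sf_0 [simp]: "const_sf 0 = 0"
  by transfer auto

lemma const_sf_1 [simp]: "const_sf 1 = 1"
  by transfer auto

lemma const_sf_add: "const_sf (a + b) = const_sf a + const_sf b"
  by transfer auto

lemma const_sf_uminus: "const_sf (- a) = - const_sf a"
  by transfer auto

lemma const_sf_diff: "const_sf (a - b) = const_sf a - const_sf b"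
  using const_sf_add[of a "- b"] by (simp add: const_sf_uminus)

lemma coeff_const_sf_mult: "coeff_sf (const_sf c * F) m = c * coeff_sf F m"
proof -
  have "(\<Sum>a | a \<subseteq># m. (if a = {#} then c else 0) * coeff_sf F (m - a)) =
      (\<Sum>a | a \<subseteq># m. if a = {#} then c * coeff_sf F m else 0)"
    by (rule sum.cong) auto
  then show ?thesis
    by (simp add: times_symfun.rep_eq const_sf.rep_eq finite_submultisets)
qed

lemma const_sf_mult: "const_sf (a * b) = const_sf a * const_sf b"
  by (rule symfun_eqI) (simp add: coeff_const_sf_mult const_sf.rep_eq)

lemma const_sf_power: "const_sf (a ^ n) = const_sf a ^ n"
  by (induction n) (simp_all add: const_sf_mult)

lemma const_sf_of_nat: "const_sf (of_nat n) = of_nat n"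
  by (induction n) (simp_all add: const_sf_add)

lemma coeff_sum_sf: "coeff_sf (sum f A) m = (\<Sum>x\<in>A. coeff_sf (f x) m)"
  by (induction A rule: infinite_finite_induct) (simp_all add: zero_symfun.rep_eq plus_symfun.rep_eq)

text \<open>For k \<ge> 1 the monomials x_i^k are distinct, so each variable whose k-th power
  divides m contributes exactly once.\<close>

lemma coeff_power_sum_mult:
  assumes "k \<ge> 1"
  shows "coeff_sf (power_sum k * F) m =
    (\<Sum>i | i \<in># m \<and> k \<le> count m i. coeff_sf F (m - replicate_mset k i))"
proof -
  let ?S = "{i. i \<in># m \<and> k \<le> count m i}"
  have inj: "inj_on (replicate_mset k) ?S"
  proof (rule inj_onI)
    fix i j assume "replicate_mset k i = (replicate_mset k j :: nat multiset)"
    then have "set_mset (replicate_mset k i) = set_mset (replicate_mset k j)" by simp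
    then show "i = j" using assms by (auto split: if_splits)
  qed
  have "coeff_sf (power_sum k * F) m =
      (\<Sum>a | a \<subseteq># m. (if \<exists>i. a = replicate_mset k i then 1 else 0) * coeff_sf F (m - a))"
    by (simp add: times_symfun.rep_eq power_sum.rep_eq)
  also have "\<dots> = (\<Sum>a\<in>replicate_mset k ` ?S. coeff_sf F (m - a))"
  proof (rule sum.mono_neutral_cong_right[OF finite_submultisets])
    show "replicate_mset k ` ?S \<subseteq> {a. a \<subseteq># m}"
      by (auto simp: count_le_replicate_mset_subset_eq)
    show "\<forall>a\<in>{a. a \<subseteq># m} - replicate_mset k ` ?S.
        (if \<exists>i. a = replicate_mset k i then 1 else 0) * coeff_sf F (m - a) = 0"
    proof
      fix a assume a: "a \<in> {a. a \<subseteq># m} - replicate_mset k ` ?S"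
      have "\<nexists>i. a = replicate_mset k i"
      proof
        assume "\<exists>i. a = replicate_mset k i"
        then obtain i where i: "a = replicate_mset k i" ..
        with a have "k \<le> count m i" by (auto simp: count_le_replicate_mset_subset_eq)
        with assms have "i \<in> ?S" by (auto simp: Suc_le_eq count_greater_zero_iff[symmetric] simp del: count_greater_zero_iff)
        with a i show False by blast
      qed
      then show "(if \<exists>i. a = replicate_mset k i then 1 else 0) * coeff_sf F (m - a) = 0" by simp
    qed
  qed auto
  also have "\<dots> = (\<Sum>i\<in>?S. coeff_sf F (m - replicate_mset k i))"
    using sum.reindex[OF inj] by simp
  finally show ?thesis .
qed

section \<open>Linear independence of the products of power sums\<close>

definition exps :: "nat multiset \<Rightarrow> nat multiset" where
  "exps m = image_mset (count m) (mset_set (set_mset m))"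

lemma size_exps: "size (exps m) = card (set_mset m)"
  by (simp add: exps_def)

lemma exps_add_replicate:
  assumes "i \<notin># m" "k \<ge> 1"
  shows "exps (m + replicate_mset k i) = add_mset k (exps m)"
proof -
  have "set_mset (m + replicate_mset k i) = insert i (set_mset m)" using assms by auto
  moreover have "image_mset (count (m + replicate_mset k i)) (mset_set (set_mset m)) =
      image_mset (count m) (mset_set (set_mset m))"
    using assms by (intro image_mset_cong) auto
  ultimately show ?thesis using assms by (simp add: exps_def not_in_iff)
qed

lemma ex_exps:
  assumes "0 \<notin># \<mu>"
  shows "\<exists>m. exps m = \<mu>"
  using assms
proof (induction \<mu>)
  case empty
  then show ?case by (auto intro!: exI[of _ "{#}"] simp: exps_def)
next
  case (add k \<mu>)
  then obtain m where m: "exps m = \<mu>" by auto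
  obtain i where "i \<notin># m" using ex_new_if_finite[OF infinite_UNIV_nat finite_set_mset] by blast
  then show ?case using exps_add_replicate[of i m k] add.prems m by auto
qed

text \<open>A monomial of the product arises by choosing a variable for each part. There are at most
  as many variables as parts, and if no two parts share a variable, the exponents are the parts
  themselves.\<close>

lemma power_sum_product_coeff_nonzero:
  assumes "0 \<notin># \<nu>" "coeff_sf (\<Prod>k\<in>#\<nu>. power_sum k :: 'a::comm_ring_1 symfun) m \<noteq> 0"
  shows "card (set_mset m) \<le> size \<nu> \<and> (card (set_mset m) = size \<nu> \<longrightarrow> exps m = \<nu>)"
  using assms
proof (induction \<nu> arbitrary: m)
  case empty
  then show ?case by (auto simp: one_symfun.rep_eq exps_def split: if_splits)
next
  case (add k \<nu>)
  then have k: "k \<ge> 1" by auto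
  from add.prems(2) have "(\<Sum>i | i \<in># m \<and> k \<le> count m i.
      coeff_sf (\<Prod>k\<in>#\<nu>. power_sum k :: 'a symfun) (m - replicate_mset k i)) \<noteq> 0"
    by (simp add: coeff_power_sum_mult[OF k])
  then obtain i where i: "i \<in># m" "k \<le> count m i"
    "coeff_sf (\<Prod>k\<in>#\<nu>. power_sum k :: 'a symfun) (m - replicate_mset k i) \<noteq> 0"
    by (auto elim!: sum.not_neutral_contains_not_neutral)
  define m' where "m' = m - replicate_mset k i"
  have m: "m = m' + replicate_mset k i"
    using i(2) by (simp add: m'_def count_le_replicate_mset_subset_eq)
  have IH: "card (set_mset m') \<le> size \<nu> \<and> (card (set_mset m') = size \<nu> \<longrightarrow> exps m' = \<nu>)"
    using add i by (auto simp: m'_def)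
  have set: "set_mset m = insert i (set_mset m')" using k by (auto simp: m)
  show ?case
  proof (cases "i \<in># m'")
    case True
    then show ?thesis using IH by (simp add: set insert_absorb)
  next
    case False
    then show ?thesis using IH exps_add_replicate[OF False k] by (auto simp: set m)
  qed
qed

text \<open>The coefficient counts the assignments of parts to variables that produce m. Being a
  natural number it cannot vanish by cancellation, so in characteristic 0 one suitable assignment
  makes it nonzero.\<close>

lemma power_sum_product_coeff_exps:
  assumes "0 \<notin># \<mu>"
  shows "\<exists>n. coeff_sf (\<Prod>k\<in>#\<mu>. power_sum k :: 'a::comm_ring_1 symfun) m = of_nat n \<and>
    (exps m = \<mu> \<longrightarrow> n > 0)"
  using assms
proof (induction \<mu> arbitrary: m)
  case empty
  show ?case
  proof (cases "m = {#}")
    case True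
    then show ?thesis by (intro exI[of _ 1]) (simp add: one_symfun.rep_eq)
  next
    case False
    then have "exps m \<noteq> {#}" using size_exps[of m] by auto
    with False show ?thesis by (intro exI[of _ 0]) (simp add: one_symfun.rep_eq)
  qed
next
  case (add k \<mu>)
  then have k: "k \<ge> 1" by auto
  let ?P = "\<lambda>m n. coeff_sf (\<Prod>k\<in>#\<mu>. power_sum k :: 'a symfun) m = of_nat n \<and> (exps m = \<mu> \<longrightarrow> n > 0)"
  have "\<forall>m. \<exists>n. ?P m n" using add by auto
  then obtain N where N: "?P m (N m)" for m by metis
  let ?S = "{i. i \<in># m \<and> k \<le> count m i}"
  let ?n = "\<Sum>i\<in>?S. N (m - replicate_mset k i)"
  have "coeff_sf (\<Prod>k\<in>#add_mset k \<mu>. power_sum k :: 'a symfun) m = of_nat ?n"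
    using N by (simp add: coeff_power_sum_mult[OF k])
  moreover have "?n > 0" if exps: "exps m = add_mset k \<mu>"
  proof -
    from exps have "k \<in># exps m" by simp
    then obtain i where i: "i \<in># m" "count m i = k" by (auto simp: exps_def)
    define m' where "m' = m - replicate_mset k i"
    have "replicate_mset k i \<subseteq># m"
      using i(2) count_le_replicate_mset_subset_eq[of k m i] by simp
    then have m: "m = m' + replicate_mset k i" by (simp add: m'_def)
    have "i \<notin># m'" using i by (simp add: m'_def not_in_iff)
    then have "exps m' = \<mu>" using exps_add_replicate[OF _ k] exps by (simp add: m)
    then have "N m' > 0" using N by blast
    then have "N (m - replicate_mset k i) > 0" by (simp add: m'_def)
    moreover have "finite ?S" "i \<in> ?S" using i by auto
    ultimately show ?thesis by (meson sum_pos2 zero_le)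
  qed
  ultimately show ?case by blast
qed

text \<open>
  A polynomial in indeterminates \<open>\<phi>\<^sub>1, \<phi>\<^sub>2, \<dots>\<close> is encoded by its coefficients, indexed by the multisets
  of the indices of the monomials.
\<close>

definition psum_eval :: "('c::comm_ring_1 \<Rightarrow> 'r::comm_ring_1) \<Rightarrow> (nat \<Rightarrow> 'r) \<Rightarrow> (nat multiset \<Rightarrow>\<^sub>0 'c) \<Rightarrow> 'r" where
  "psum_eval \<kappa> \<phi> c = (\<Sum>\<mu>\<in>Poly_Mapping.keys c. \<kappa> (Poly_Mapping.lookup c \<mu>) * (\<Prod>k\<in>#\<mu>. \<phi> k))"

lemma psum_eval_superset:
  assumes "\<kappa> 0 = 0" "finite A" "Poly_Mapping.keys c \<subseteq> A"
  shows "psum_eval \<kappa> \<phi> c = (\<Sum>\<mu>\<in>A. \<kappa> (Poly_Mapping.lookup c \<mu>) * (\<Prod>k\<in>#\<mu>. \<phi> k))"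
  unfolding psum_eval_def using assms
  by (intro sum.mono_neutral_left) (auto simp: in_keys_iff)

lemma psum_eval_add:
  assumes "\<kappa> 0 = 0" "\<And>a b. \<kappa> (a + b) = \<kappa> a + \<kappa> b"
  shows "psum_eval \<kappa> \<phi> (c + d) = psum_eval \<kappa> \<phi> c + psum_eval \<kappa> \<phi> d"
proof -
  let ?A = "Poly_Mapping.keys c \<union> Poly_Mapping.keys d"
  have "psum_eval \<kappa> \<phi> x = (\<Sum>\<mu>\<in>?A. \<kappa> (Poly_Mapping.lookup x \<mu>) * (\<Prod>k\<in>#\<mu>. \<phi> k))" if "x \<in> {c, d, c + d}" for x
    using that Poly_Mapping.keys_add[of c d] by (intro psum_eval_superset[of \<kappa>] assms(1)) auto
  then show ?thesis
    by (simp add: assms lookup_add sum.distrib[symmetric] algebra_simps)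
qed

lemma psum_eval_single:
  assumes "\<kappa> 0 = 0"
  shows "psum_eval \<kappa> \<phi> (Poly_Mapping.single \<mu> a) = \<kappa> a * (\<Prod>k\<in>#\<mu>. \<phi> k)"
  using psum_eval_superset[of \<kappa> "{\<mu>}" "Poly_Mapping.single \<mu> a"] assms by simp

lemma poly_mapping_induct_add_single [case_names zero add]:
  assumes "P 0" "\<And>\<mu> a c. P c \<Longrightarrow> \<mu> \<notin> Poly_Mapping.keys c \<Longrightarrow> a \<noteq> 0 \<Longrightarrow> P (Poly_Mapping.single \<mu> a + c)"
  shows "P (c :: 'b \<Rightarrow>\<^sub>0 'c::comm_ring_1)"
proof (induction c rule: update_induct)
  case const
  show ?case by (rule assms)
next
  case (update c \<mu> a)
  have "Poly_Mapping.update \<mu> a c = Poly_Mapping.single \<mu> a + c"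
    using update(1) by (intro poly_mapping_eqI) (auto simp: lookup_update lookup_add lookup_single in_keys_iff when_def)
  with update assms(2) show ?case by simp
qed

text \<open>Used with \<open>const_sf\<close> and with \<open>cst\<close> for \<kappa>: forming a
  symmetric function from its expansion and substituting into that expansion are both ring
  homomorphisms.\<close>

lemma psum_eval_mult:
  assumes "\<kappa> 0 = 0" "\<And>a b. \<kappa> (a + b) = \<kappa> a + \<kappa> b" "\<And>a b. \<kappa> (a * b) = \<kappa> a * \<kappa> b"
  shows "psum_eval \<kappa> \<phi> (c * d) = psum_eval \<kappa> \<phi> c * psum_eval \<kappa> \<phi> d"
proof (induction c rule: poly_mapping_induct_add_single)
  case zero
  show ?case by (simp add: psum_eval_def)
next
  case (add \<mu> a c)
  have "psum_eval \<kappa> \<phi> (Poly_Mapping.single \<mu> a * d) = psum_eval \<kappa> \<phi> (Poly_Mapping.single \<mu> a) * psum_eval \<kappa> \<phi> d"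
  proof (induction d rule: poly_mapping_induct_add_single)
    case zero
    show ?case by (simp add: psum_eval_def)
  next
    case (add \<nu> b d)
    then show ?case
      by (simp add: distrib_left psum_eval_add assms Poly_Mapping.mult_single psum_eval_single image_mset_union algebra_simps)
  qed
  with add show ?case by (simp add: distrib_right psum_eval_add assms)
qed

lemma power_sum_expansion_eval:
  "power_sum_expansion c F \<longleftrightarrow>
    (\<forall>\<mu>\<in>Poly_Mapping.keys c. 0 \<notin># \<mu>) \<and> F = psum_eval const_sf power_sum c"
  by (simp add: power_sum_expansion_def psum_eval_def)

text \<open>
  If \<open>\<mu>\<close> has the largest possible number of parts, then the monomial with exponents \<open>\<mu>\<close> occurs in
  \<open>p\<^sub>\<mu>\<close>, but in no other of the \<open>p\<^sub>\<nu>\<close> involved.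
\<close>

lemma psum_eval_power_sum_eq_0:
  fixes c :: "nat multiset \<Rightarrow>\<^sub>0 'a::{comm_ring_1, ring_char_0, idom}"
  assumes "\<forall>\<mu>\<in>Poly_Mapping.keys c. 0 \<notin># \<mu>" "psum_eval const_sf power_sum c = 0"
  shows "c = 0"
proof (rule ccontr)
  let ?p = "\<lambda>\<mu>. \<Prod>k\<in>#\<mu>. power_sum k :: 'a symfun"
  assume "c \<noteq> 0"
  then have ne: "Poly_Mapping.keys c \<noteq> {}" by simp
  define N where "N = Max (size ` Poly_Mapping.keys c)"
  have le: "size \<nu> \<le> N" if "\<nu> \<in> Poly_Mapping.keys c" for \<nu>
    using that by (simp add: N_def)
  have "N \<in> size ` Poly_Mapping.keys c" unfolding N_def using ne by (intro Max_in) auto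
  then obtain \<mu> where \<mu>: "\<mu> \<in> Poly_Mapping.keys c" "size \<mu> = N" by auto
  from \<mu> assms(1) obtain m where m: "exps m = \<mu>" using ex_exps by blast
  then have card: "card (set_mset m) = N" using \<mu> by (simp add: size_exps[symmetric])
  have 0: "coeff_sf (?p \<nu>) m = 0" if "\<nu> \<in> Poly_Mapping.keys c - {\<mu>}" for \<nu>
  proof (rule ccontr)
    assume "coeff_sf (?p \<nu>) m \<noteq> 0"
    with power_sum_product_coeff_nonzero[of \<nu> m] assms(1) that
    have "N \<le> size \<nu>" "N = size \<nu> \<longrightarrow> \<mu> = \<nu>" by (auto simp: card m)
    with le[of \<nu>] that show False by auto
  qed
  have "0 = coeff_sf (psum_eval const_sf power_sum c) m" using assms(2) by (simp add: zero_symfun.rep_eq)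
  also have "\<dots> = (\<Sum>\<nu>\<in>Poly_Mapping.keys c. Poly_Mapping.lookup c \<nu> * coeff_sf (?p \<nu>) m)"
    by (simp add: psum_eval_def coeff_sum_sf coeff_const_sf_mult)
  also have "\<dots> = Poly_Mapping.lookup c \<mu> * coeff_sf (?p \<mu>) m"
    using 0 \<mu> by (subst sum.remove[of _ \<mu>]) auto
  finally have "coeff_sf (?p \<mu>) m = 0" using \<mu> by (simp add: in_keys_iff)
  moreover obtain n where "coeff_sf (?p \<mu>) m = of_nat n" "n > 0"
    using power_sum_product_coeff_exps[of \<mu> m] assms(1) \<mu> m by blast
  ultimately show False by simp
qed

lemma power_sum_expansion_unique:
  assumes "power_sum_expansion c F" "power_sum_expansion d F"
  shows "c = d"
proof -
  have "psum_eval const_sf power_sum (c - d) + psum_eval const_sf power_sum d = psum_eval const_sf power_sum (c :: nat multiset \<Rightarrow>\<^sub>0 Qq)"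
    by (subst psum_eval_add[symmetric]) (simp_all add: const_sf_add)
  then have "psum_eval const_sf power_sum (c - d) = 0" using assms by (simp add: power_sum_expansion_eval)
  moreover have "\<forall>\<mu>\<in>Poly_Mapping.keys (c - d). 0 \<notin># \<mu>"
    using assms keys_diff[of c d] by (auto simp: power_sum_expansion_eval)
  ultimately have "c - d = 0" using psum_eval_power_sum_eq_0 by blast
  then show ?thesis by simp
qed

section \<open>Plethysm on polynomials in the power sums\<close>

lemma X_poly_power: "[:0, 1:] ^ n = monom (1 :: 'a::comm_ring_1) n"
  by (induction n) (simp_all add: monom_0 monom_Suc one_pCons)

lemma to_fract_power: "to_fract p ^ n = to_fract (p ^ n)"
  by (induction n) (simp_all add: One_fract_def to_fract_def)

lemma pcompose_monom_nonzero:
  fixes b :: "'a::idom poly"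
  assumes "k \<ge> 1" "b \<noteq> 0"
  shows "pcompose b (monom 1 k) \<noteq> 0"
  using assms by (simp add: pcompose_eq_0_iff degree_monom_eq)

text \<open>\<open>frob_q\<close> refers to the normalized quotient. Cross multiplication survives
  the substitution and denominators stay nonzero, so any representative may be used; the field
  homomorphism laws follow from this.\<close>

lemma frob_q_Fract:
  assumes "k \<ge> 1" "b \<noteq> 0"
  shows "frob_q k (Fract a b) = Fract (pcompose a (monom 1 k)) (pcompose b (monom 1 k))"
proof -
  obtain c d where cd: "quot_of_fract (Fract a b) = (c, d)" by fastforce
  have "d \<noteq> 0" using snd_quot_of_fract_nonzero[of "Fract a b"] cd by simp
  have "Fract c d = Fract a b"
    using quot_to_fract_quot_of_fract[of "Fract a b"] cd \<open>d \<noteq> 0\<close>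
    by (simp add: quot_to_fract_def Fract.abs_eq)
  then have "c * b = a * d" using \<open>d \<noteq> 0\<close> assms by (simp add: eq_fract)
  then have "pcompose c (monom 1 k) * pcompose b (monom 1 k) =
      pcompose a (monom 1 k) * pcompose d (monom 1 k)" by (metis pcompose_mult)
  moreover have "pcompose b (monom 1 k) \<noteq> 0" "pcompose d (monom 1 k) \<noteq> 0"
    using assms \<open>d \<noteq> 0\<close> by (simp_all add: pcompose_monom_nonzero)
  ultimately show ?thesis by (simp add: frob_q_def cd eq_fract)
qed

lemma frob_q_add: "k \<ge> 1 \<Longrightarrow> frob_q k (x + y) = frob_q k x + frob_q k y"
  by (cases x, cases y)
    (simp add: frob_q_Fract pcompose_monom_nonzero pcompose_add pcompose_mult)

lemma frob_q_mult: "k \<ge> 1 \<Longrightarrow> frob_q k (x * y) = frob_q k x * frob_q k y"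
  by (cases x, cases y)
    (simp add: frob_q_Fract pcompose_monom_nonzero pcompose_mult)

lemma frob_q_1: "k \<ge> 1 \<Longrightarrow> frob_q k 1 = 1"
  by (simp add: One_fract_def frob_q_Fract pcompose_1)

lemma frob_q_uminus: "k \<ge> 1 \<Longrightarrow> frob_q k (- x) = - frob_q k x"
  using frob_q_add[of k x "- x"] by (simp add: eq_neg_iff_add_eq_0 add.commute)

lemma frob_q_diff: "k \<ge> 1 \<Longrightarrow> frob_q k (x - y) = frob_q k x - frob_q k y"
  using frob_q_add[of k x "- y"] by (simp add: frob_q_uminus)

lemma frob_q_inverse: "k \<ge> 1 \<Longrightarrow> frob_q k (inverse x) = inverse (frob_q k x)"
  using frob_q_mult[of k x "inverse x"]
  by (cases "x = 0") (simp_all add: frob_q_1 inverse_unique)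

lemma frob_q_divide: "k \<ge> 1 \<Longrightarrow> frob_q k (x / y) = frob_q k x / frob_q k y"
  by (simp add: divide_inverse frob_q_mult frob_q_inverse)

lemma frob_q_power: "k \<ge> 1 \<Longrightarrow> frob_q k (x ^ n) = frob_q k x ^ n"
  by (induction n) (simp_all add: frob_q_1 frob_q_mult)

lemma frob_q_powi: "k \<ge> 1 \<Longrightarrow> frob_q k (x powi n) = frob_q k x powi n"
  by (simp add: power_int_def frob_q_power frob_q_inverse)

lemma frob_q_q: "k \<ge> 1 \<Longrightarrow> frob_q k q = q ^ k"
  by (simp add: q_def to_fract_power X_poly_power)
    (simp add: to_fract_def frob_q_Fract pcompose_pCons pcompose_1)

lemma q_nonzero [simp]: "q \<noteq> 0"
  by (simp add: q_def)

lemma q_power_neq_1: "n \<ge> 1 \<Longrightarrow> q ^ n \<noteq> 1"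
proof
  assume "n \<ge> 1" "q ^ n = 1"
  then have "monom 1 n = (1 :: rat poly)"
    by (simp add: q_def to_fract_power X_poly_power) (simp add: One_fract_def to_fract_def eq_fract)
  with \<open>n \<ge> 1\<close> show False by (metis degree_1 degree_monom_eq not_one_le_zero zero_neq_one)
qed

lemma q_powi_neq_1: "n \<noteq> 0 \<Longrightarrow> q powi n \<noteq> 1"
  using q_power_neq_1[of "nat n"] q_power_neq_1[of "nat (- n)"]
  by (auto simp: power_int_def power_inverse)

section \<open>Values of p_k on the alphabets that occur\<close>

lemma repeat_mset_eq_empty: "k \<ge> 1 \<Longrightarrow> repeat_mset k a = {#} \<longleftrightarrow> a = {#}"
  by (metis not_one_le_zero repeat_mset_cancel1 repeat_mset_empty)

lemma frob_sf_const:
  assumes "k \<ge> 1"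
  shows "frob_sf k (const_sf c) = const_sf (frob_q k c)"
proof (rule symfun_eqI)
  fix m
  show "coeff_sf (frob_sf k (const_sf c)) m = coeff_sf (const_sf (frob_q k c)) m"
  proof (cases "m = {#}")
    case True
    then have "{a. repeat_mset k a = m} = {{#}}" using assms by (simp add: repeat_mset_eq_empty)
    with True show ?thesis by (simp add: frob_sf.rep_eq const_sf.rep_eq)
  next
    case False
    then have "frob_q k (if a = {#} then c else 0) = 0" if "repeat_mset k a = m" for a
      using that by auto
    with False show ?thesis by (simp add: frob_sf.rep_eq const_sf.rep_eq)
  qed
qed

lemma frob_sf_const_power_sum:
  assumes "k \<ge> 1"
  shows "frob_sf k (const_sf c * power_sum 1) = const_sf (frob_q k c) * power_sum k"
proof (rule symfun_eqI)
  fix m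
  have p1: "coeff_sf (const_sf c * power_sum 1) a = (if \<exists>i. a = {#i#} then c else 0)" for a
    by (simp add: coeff_const_sf_mult power_sum.rep_eq)
  show "coeff_sf (frob_sf k (const_sf c * power_sum 1)) m =
      coeff_sf (const_sf (frob_q k c) * power_sum k) m"
  proof (cases "\<exists>i. m = replicate_mset k i")
    case True
    then obtain i where i: "m = replicate_mset k i" ..
    then have "m = repeat_mset k {#i#}" by simp
    then have "{a. repeat_mset k a = m} = {{#i#}}"
      using assms repeat_mset_cancel1[of k _ "{#i#}"] by auto
    then show ?thesis using True by (simp add: frob_sf.rep_eq p1 coeff_const_sf_mult power_sum.rep_eq)
  next
    case False
    then have "\<nexists>i. a = {#i#}" if "repeat_mset k a = m" for a
      using that by auto
    then have "coeff_sf (frob_sf k (const_sf c * power_sum 1)) m = 0"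
      unfolding frob_sf.rep_eq p1 by (intro sum.neutral) simp
    with False show ?thesis by (simp add: coeff_const_sf_mult power_sum.rep_eq)
  qed
qed

lemma power_sum_pleth_nth:
  "k \<ge> 1 \<Longrightarrow> fls_nth (power_sum_pleth k E) j =
    (if int k dvd j then frob_sf k (fls_nth E (j div int k)) else 0)"
  by (simp add: power_sum_pleth.rep_eq fls_nth_compose_power)

lemma power_sum_pleth_shift:
  assumes "k \<ge> 1"
  shows "power_sum_pleth k (X + cst c * fls_X_inv) =
    fls_const (power_sum k) + cst (frob_q k c) * fls_X_inv ^ k"
proof (rule fls_eqI)
  fix j :: int
  have 1: "frob_sf k (power_sum 1) = power_sum k"
    using frob_sf_const_power_sum[OF assms, of 1] assms by (simp add: frob_q_1)
  have "j div int k = -1 \<longleftrightarrow> j = - int k" "j div int k = 0 \<longleftrightarrow> j = 0" if "int k dvd j"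
    proof -
    from that obtain l where l: "j = int k * l" ..
    have "int k * l = - int k \<longleftrightarrow> l = -1"
      using assms mult_cancel_left[of "int k" l "-1"] by simp
    with l assms show "j div int k = -1 \<longleftrightarrow> j = - int k" "j div int k = 0 \<longleftrightarrow> j = 0"
      by simp_all
  qed
  then show "fls_nth (power_sum_pleth k (X + cst c * fls_X_inv)) j =
      fls_nth (fls_const (power_sum k) + cst (frob_q k c) * fls_X_inv ^ k) j"
    using assms by (auto simp: power_sum_pleth_nth frob_sf_const 1 simp del: One_nat_def)
qed

lemma power_sum_pleth_neg_X:
  assumes "k \<ge> 1"
  shows "fls_nth (power_sum_pleth k (- (fls_X * cst c * X))) j =
    (if j = int k then - (const_sf (frob_q k c) * power_sum k) else 0)"
proof -
  have E: "fls_X * cst c * X = fls_X * fls_const (const_sf c * power_sum 1)"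
    by (simp add: mult.assoc)
  have 1: "frob_sf k (- (const_sf c * power_sum 1)) = - (const_sf (frob_q k c) * power_sum k)"
    using frob_sf_const_power_sum[OF assms, of "- c"] assms
    by (simp add: const_sf_uminus frob_q_uminus)
  have "j div int k = 1 \<longleftrightarrow> j = int k" if "int k dvd j"
    using that assms by auto
  then show ?thesis
    using assms unfolding E by (auto simp: power_sum_pleth_nth 1 fls_X_times_conv_shift simp del: One_nat_def)
qed

lemma power_sum_pleth_X_cst:
  assumes "k \<ge> 1"
  shows "power_sum_pleth k (X * cst c) = fls_const (const_sf (frob_q k c) * power_sum k)"
proof (rule fls_eqI)
  fix j :: int
  have "j div int k = 0 \<longleftrightarrow> j = 0" if "int k dvd j" using that assms by auto
  then show "fls_nth (power_sum_pleth k (X * cst c)) j =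
      fls_nth (fls_const (const_sf (frob_q k c) * power_sum k)) j"
    using assms frob_sf_const_power_sum[OF assms, of c]
    by (auto simp: power_sum_pleth_nth mult.commute)
qed

section \<open>Plethystic substitution as a ring homomorphism\<close>

definition psum_polys :: "Qq symfun set" where
  "psum_polys = {F. \<exists>c. power_sum_expansion c F}"

text \<open>Uniqueness of the expansion resolves the definite description; from here on
  \<open>pleth\<close> is evaluation of a polynomial at the p_k[E].\<close>

lemma pleth_eval:
  assumes "\<forall>\<mu>\<in>Poly_Mapping.keys c. 0 \<notin># \<mu>"
  shows "pleth (psum_eval const_sf power_sum c) E = psum_eval (\<lambda>a. cst a) (\<lambda>k. power_sum_pleth k E) c"
proof -
  have "(THE d. power_sum_expansion d (psum_eval const_sf power_sum c)) = c"
    using assms by (intro the_equality) (auto simp: power_sum_expansion_eval intro: power_sum_expansion_unique)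
  then show ?thesis by (simp add: pleth_def psum_eval_def)
qed

lemma psum_polys_E:
  assumes "F \<in> psum_polys"
  obtains c where "\<forall>\<mu>\<in>Poly_Mapping.keys c. 0 \<notin># \<mu>" "F = psum_eval const_sf power_sum c"
  using assms by (auto simp: psum_polys_def power_sum_expansion_eval)

lemma psum_polys_I: "\<forall>\<mu>\<in>Poly_Mapping.keys c. 0 \<notin># \<mu> \<Longrightarrow> psum_eval const_sf power_sum c \<in> psum_polys"
  by (auto simp: psum_polys_def power_sum_expansion_eval)

lemma psum_polys_const: "const_sf a \<in> psum_polys"
  and pleth_const: "pleth (const_sf a) E = cst a"
proof -
  have c: "const_sf a = psum_eval const_sf power_sum (Poly_Mapping.single {#} a)"
    by (simp add: psum_eval_single)
  have k: "\<forall>\<mu>\<in>Poly_Mapping.keys (Poly_Mapping.single {#} a). 0 \<notin># \<mu>" by auto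
  show "const_sf a \<in> psum_polys" unfolding c using k by (rule psum_polys_I)
  show "pleth (const_sf a) E = cst a" unfolding c pleth_eval[OF k] by (simp add: psum_eval_single)
qed

lemma psum_polys_power_sum: "k \<ge> 1 \<Longrightarrow> power_sum k \<in> psum_polys"
  and pleth_power_sum: "k \<ge> 1 \<Longrightarrow> pleth (power_sum k) E = power_sum_pleth k E"
proof -
  have c: "power_sum k = psum_eval const_sf power_sum (Poly_Mapping.single {#k#} (1 :: Qq))"
    by (simp add: psum_eval_single)
  assume "k \<ge> 1"
  then have k: "\<forall>\<mu>\<in>Poly_Mapping.keys (Poly_Mapping.single {#k#} (1 :: Qq)). 0 \<notin># \<mu>" by auto
  show "power_sum k \<in> psum_polys" unfolding c using k by (rule psum_polys_I)
  show "pleth (power_sum k) E = power_sum_pleth k E"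
    unfolding c pleth_eval[OF k] by (simp add: psum_eval_single)
qed

lemma assumes "F \<in> psum_polys" "G \<in> psum_polys"
  shows psum_polys_add: "F + G \<in> psum_polys"
    and pleth_add: "pleth (F + G) E = pleth F E + pleth G E"
    and psum_polys_mult: "F * G \<in> psum_polys"
    and pleth_mult: "pleth (F * G) E = pleth F E * pleth G E"
proof -
  from assms obtain c d where c: "\<forall>\<mu>\<in>Poly_Mapping.keys c. 0 \<notin># \<mu>" "F = psum_eval const_sf power_sum c"
    and d: "\<forall>\<mu>\<in>Poly_Mapping.keys d. 0 \<notin># \<mu>" "G = psum_eval const_sf power_sum d"
    by (metis psum_polys_E)
  have add: "\<forall>\<mu>\<in>Poly_Mapping.keys (c + d). 0 \<notin># \<mu>"
    using c d Poly_Mapping.keys_add[of c d] by blast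
  have mult: "\<forall>\<mu>\<in>Poly_Mapping.keys (c * d). 0 \<notin># \<mu>"
    using c d Poly_Mapping.keys_mult[of c d] by fastforce
  have FG: "F + G = psum_eval const_sf power_sum (c + d)" "F * G = psum_eval const_sf power_sum (c * d)"
    by (simp_all add: c d psum_eval_add psum_eval_mult const_sf_add const_sf_mult)
  show "F + G \<in> psum_polys" "F * G \<in> psum_polys" unfolding FG using add mult by (auto intro: psum_polys_I)
  show "pleth (F + G) E = pleth F E + pleth G E"
    unfolding FG pleth_eval[OF add]
    by (simp add: c d pleth_eval psum_eval_add const_sf_add fls_plus_const[symmetric])
  show "pleth (F * G) E = pleth F E * pleth G E"
    unfolding FG pleth_eval[OF mult]
    by (simp add: c d pleth_eval psum_eval_mult const_sf_add const_sf_mult fls_plus_const[symmetric])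
qed

lemma psum_polys_0: "0 \<in> psum_polys" and psum_polys_1: "1 \<in> psum_polys"
  using psum_polys_const[of 0] psum_polys_const[of 1] by simp_all

lemma psum_polys_uminus: "F \<in> psum_polys \<Longrightarrow> - F \<in> psum_polys"
  using psum_polys_mult[OF psum_polys_const[of "-1"], of F] by (simp add: const_sf_uminus)

lemma psum_polys_sum: "(\<And>i. i \<in> A \<Longrightarrow> f i \<in> psum_polys) \<Longrightarrow> sum f A \<in> psum_polys"
  by (induction A rule: infinite_finite_induct) (auto intro: psum_polys_0 psum_polys_add)

lemma pleth_uminus:
  assumes "F \<in> psum_polys"
  shows "pleth (- F) E = - pleth F E"
proof -
  have "pleth (const_sf (- 1) * F) E = cst (- 1) * pleth F E"
    by (simp only: pleth_mult[OF psum_polys_const assms] pleth_const)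
  then show ?thesis by (simp add: const_sf_uminus)
qed

lemma pleth_sum: "(\<And>i. i \<in> A \<Longrightarrow> f i \<in> psum_polys) \<Longrightarrow> pleth (sum f A) E = (\<Sum>i\<in>A. pleth (f i) E)"
  by (induction A rule: infinite_finite_induct)
    (use pleth_const[of 0] in \<open>auto simp: pleth_add psum_polys_sum\<close>)

text \<open>Products enter only through a single factor p_k, because multiplication by p_k is what
  can be moved past the operators D, see \<open>D_power_sum_mult\<close>.\<close>

lemma psum_polys_induct [consumes 1, case_names const add power_sum]:
  assumes "F \<in> psum_polys"
    and "\<And>a. P (const_sf a)"
    and "\<And>F G. F \<in> psum_polys \<Longrightarrow> G \<in> psum_polys \<Longrightarrow> P F \<Longrightarrow> P G \<Longrightarrow> P (F + G)"
    and "\<And>k F. k \<ge> 1 \<Longrightarrow> F \<in> psum_polys \<Longrightarrow> P F \<Longrightarrow> P (power_sum k * F)"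
  shows "P F"
proof -
  have mono: "const_sf a * (\<Prod>k\<in>#\<mu>. power_sum k) \<in> psum_polys \<and> P (const_sf a * (\<Prod>k\<in>#\<mu>. power_sum k))"
    if "0 \<notin># \<mu>" for \<mu> a
    using that
  proof (induction \<mu>)
    case empty
    show ?case by (simp add: psum_polys_const assms)
  next
    case (add k \<mu>)
    then have k: "k \<ge> 1" and IH: "const_sf a * (\<Prod>k\<in>#\<mu>. power_sum k) \<in> psum_polys"
      "P (const_sf a * (\<Prod>k\<in>#\<mu>. power_sum k))" by auto
    show ?case
      using psum_polys_mult[OF psum_polys_power_sum[OF k] IH(1)] assms(4)[OF k IH] by (simp add: mult.left_commute)
  qed
  from assms(1) obtain c where c: "\<forall>\<mu>\<in>Poly_Mapping.keys c. 0 \<notin># \<mu>" "F = psum_eval const_sf power_sum c"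
    by (rule psum_polys_E)
  have "sum f A \<in> psum_polys \<and> P (sum f A)" if "\<And>x. x \<in> A \<Longrightarrow> f x \<in> psum_polys \<and> P (f x)"
    for f and A :: "nat multiset set"
    using that
    by (induction A rule: infinite_finite_induct)
      (use psum_polys_0 assms(2)[of 0] in \<open>auto simp: psum_polys_add assms(3)\<close>)
  then show ?thesis using c mono by (auto simp: psum_eval_def)
qed

section \<open>Newton recursions\<close>

text \<open>
  On coefficients, this is the recursion \<open>n h\<^sub>n = - \<Sum>\<^sub>k b\<^sub>k h\<^sub>n\<^sub>-\<^sub>k\<close>, which says that
  \<open>H(z) = exp (- \<Sum>\<^sub>k b\<^sub>k z\<^sup>k / k)\<close>.
\<close>

definition newton :: "'a::comm_ring_1 fps \<Rightarrow> 'a fps \<Rightarrow> bool" where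
  "newton B H \<longleftrightarrow> fps_nth B 0 = 0 \<and> fps_nth H 0 = 1 \<and> fps_X * fps_deriv H = - (B * H)"

lemma newton_nth:
  "newton B H \<longleftrightarrow> fps_nth B 0 = 0 \<and> fps_nth H 0 = 1 \<and>
    (\<forall>n. of_nat n * fps_nth H n = - (\<Sum>i=0..n. fps_nth B i * fps_nth H (n - i)))"
proof -
  have "fps_nth (fps_X * fps_deriv H) n = of_nat n * fps_nth H n" for n
    by (cases n) simp_all
  then show ?thesis by (simp add: newton_def fps_eq_iff fps_mult_nth)
qed

text \<open>B is minus the logarithmic derivative z H'/H, which turns products into sums.\<close>

lemma newton_mult:
  assumes "newton B H" "newton C K"
  shows "newton (B + C) (H * K)"
proof -
  have "fps_X * fps_deriv (H * K) = H * (fps_X * fps_deriv K) + (fps_X * fps_deriv H) * K"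
    by (simp add: algebra_simps)
  also have "\<dots> = - ((B + C) * (H * K))"
    using assms by (simp add: newton_def algebra_simps)
  finally show ?thesis using assms by (simp add: newton_def)
qed

text \<open>As B has no constant term, the recursion expresses n H_n by earlier coefficients.
  Invertibility of n is a separate hypothesis because the coefficient rings in question are
  symmetric functions and Laurent series over them.\<close>

lemma newton_unique:
  fixes H K :: "'a::comm_ring_1 fps"
  assumes "newton B H" "newton B K" "\<And>n. n > 0 \<Longrightarrow> \<exists>c::'a. c * of_nat n = 1"
  shows "H = K"
proof -
  have "fps_nth H n = fps_nth K n" for n
  proof (induction n rule: less_induct)
    case (less n)
    show ?case
    proof (cases "n = 0")
      case True
      with assms show ?thesis by (simp add: newton_def)
    next
      case False
      then obtain c :: 'a where c: "c * of_nat n = 1" using assms(3) by auto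
      have "(\<Sum>i=0..n. fps_nth B i * fps_nth H (n - i)) = (\<Sum>i=0..n. fps_nth B i * fps_nth K (n - i))"
      proof (rule sum.cong)
        fix i assume "i \<in> {0..n}"
        then show "fps_nth B i * fps_nth H (n - i) = fps_nth B i * fps_nth K (n - i)"
          using less[of "n - i"] False assms(1) by (cases "i = 0") (auto simp: newton_def)
      qed simp
      then have "of_nat n * fps_nth H n = of_nat n * fps_nth K n"
        using assms(1,2) unfolding newton_nth by metis
      then have "c * of_nat n * fps_nth H n = c * of_nat n * fps_nth K n" by (simp add: mult.assoc)
      with c show ?thesis by simp
    qed
  qed
  then show ?thesis by (simp add: fps_eq_iff)
qed

text \<open>The substitution of c z for z. It serves for powers of q and also for c =
  \<open>fls_X_inv\<close>, where a second variable is present.\<close>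

lemma newton_scale:
  assumes "newton B H"
  shows "newton (Abs_fps (\<lambda>n. c ^ n * fps_nth B n)) (Abs_fps (\<lambda>n. c ^ n * fps_nth H n))"
proof -
  have "of_nat n * (c ^ n * fps_nth H n) =
      - (\<Sum>i=0..n. c ^ i * fps_nth B i * (c ^ (n - i) * fps_nth H (n - i)))" for n
  proof -
    have "(\<Sum>i=0..n. c ^ i * fps_nth B i * (c ^ (n - i) * fps_nth H (n - i))) =
        (\<Sum>i=0..n. c ^ n * (fps_nth B i * fps_nth H (n - i)))"
    proof (rule sum.cong)
      fix i assume "i \<in> {0..n}"
      then have "c ^ n = c ^ i * c ^ (n - i)" by (simp add: power_add[symmetric])
      then show "c ^ i * fps_nth B i * (c ^ (n - i) * fps_nth H (n - i)) =
          c ^ n * (fps_nth B i * fps_nth H (n - i))" by (simp add: ac_simps)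
    qed simp
    also have "\<dots> = c ^ n * (\<Sum>i=0..n. fps_nth B i * fps_nth H (n - i))"
      by (simp add: sum_distrib_left)
    also have "\<dots> = - (c ^ n * (of_nat n * fps_nth H n))"
      using assms by (simp add: newton_nth)
    finally show ?thesis by (simp add: ac_simps)
  qed
  with assms show ?thesis by (simp add: newton_nth)
qed

lemma newton_hom:
  assumes "newton B H"
    and "\<kappa> 1 = 1" "\<And>a b. \<kappa> (a + b) = \<kappa> a + \<kappa> b" "\<And>a b. \<kappa> (a * b) = \<kappa> a * \<kappa> b"
  shows "newton (Abs_fps (\<lambda>n. \<kappa> (fps_nth B n))) (Abs_fps (\<lambda>n. \<kappa> (fps_nth H n)))"
proof -
  have 0: "\<kappa> 0 = 0" using assms(3)[of 0 0] by simp
  have minus: "\<kappa> (- a) = - \<kappa> a" for a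
    using assms(3)[of a "- a"] by (simp add: 0 eq_neg_iff_add_eq_0 add.commute)
  have of_nat: "\<kappa> (of_nat n) = of_nat n" for n
    by (induction n) (simp_all add: 0 assms)
  have sum: "\<kappa> (sum f A) = (\<Sum>x\<in>A. \<kappa> (f x))" for f and A :: "nat set"
    by (induction A rule: infinite_finite_induct) (simp_all add: 0 assms)
  have "of_nat n * \<kappa> (fps_nth H n) = - (\<Sum>i=0..n. \<kappa> (fps_nth B i) * \<kappa> (fps_nth H (n - i)))" for n
  proof -
    have "of_nat n * \<kappa> (fps_nth H n) = \<kappa> (of_nat n * fps_nth H n)"
      by (simp only: assms(4) of_nat)
    also have "of_nat n * fps_nth H n = - (\<Sum>i=0..n. fps_nth B i * fps_nth H (n - i))"
      using assms(1) by (simp add: newton_nth)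
    also have "\<kappa> \<dots> = - (\<Sum>i=0..n. \<kappa> (fps_nth B i) * \<kappa> (fps_nth H (n - i)))"
      by (simp only: minus sum assms(4))
    finally show ?thesis .
  qed
  with assms(1) show ?thesis by (simp add: newton_nth 0 assms(2))
qed

text \<open>This is \<Omega>[- a z] = 1 - a z, with B = a z / (1 - a z).\<close>

lemma newton_linear: "newton (Abs_fps (\<lambda>n. if n = 0 then 0 else a ^ n)) (1 - fps_const a * fps_X)"
proof -
  let ?B = "Abs_fps (\<lambda>n. if n = 0 then 0 else a ^ n)"
  have "?B * (1 - fps_const a * fps_X) = fps_const a * fps_X"
  proof (rule fps_ext)
    fix n
    have "?B * (1 - fps_const a * fps_X) = ?B - fps_const a * (?B * fps_X)"
      by (simp add: algebra_simps)
    then show "fps_nth (?B * (1 - fps_const a * fps_X)) n = fps_nth (fps_const a * fps_X) n"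
      by (cases n) simp_all
  qed
  then show ?thesis by (simp add: newton_def mult.commute)
qed

lemma newton_geometric:
  "newton (- Abs_fps (\<lambda>n. if n = 0 then 0 else a ^ n)) (Abs_fps (\<lambda>n. a ^ n))"
proof -
  have "of_nat n * a ^ n = (\<Sum>i=0..n. (if i = 0 then 0 else a ^ i) * a ^ (n - i))" for n
  proof -
    have "(\<Sum>i=0..n. (if i = 0 then 0 else a ^ i) * a ^ (n - i)) = (\<Sum>i=0..n. if i = 0 then 0 else a ^ n)"
      by (rule sum.cong) (auto simp: power_add[symmetric])
    also have "\<dots> = (\<Sum>i=1..n. a ^ n)"
      by (rule sum.mono_neutral_cong_right) auto
    finally show ?thesis by simp
  qed
  then show ?thesis by (simp add: newton_nth sum_negf)
qed

lemma geometric_mult: "(1 - fps_const a * fps_X) * Abs_fps (\<lambda>n. a ^ n) = (1 :: 'a::comm_ring_1 fps)"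
proof (rule fps_ext)
  fix n
  have "(1 - fps_const a * fps_X) * Abs_fps (\<lambda>n. a ^ n) =
      Abs_fps (\<lambda>n. a ^ n) - fps_const a * (fps_X * Abs_fps (\<lambda>n. a ^ n))"
    by (simp add: algebra_simps)
  then show "fps_nth ((1 - fps_const a * fps_X) * Abs_fps (\<lambda>n. a ^ n)) n = fps_nth (1 :: 'a fps) n"
    by (cases n) simp_all
qed

text \<open>The series \<open>\<Omega>[- z [u]\<^sub>t X]\<close>.\<close>

definition omega_series :: "int \<Rightarrow> Qq symfun fps" where
  "omega_series u = Abs_fps (\<lambda>n. \<Sum>j\<le>n. const_sf (1 / fact j) *
     fps_nth (log_Omega (- (fls_X * cst (qint t u) * X)) ^ j) n)"

section \<open>Exponential series and the recursion of \<open>omega_series\<close>\<close>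

lemma fps_power_nth_eq_0:
  fixes L :: "'a::comm_ring_1 fps"
  assumes "fps_nth L 0 = 0" "n < j"
  shows "fps_nth (L ^ j) n = 0"
  using assms startsby_zero_power_prefix by blast

text \<open>This is (exp L)' = L' exp L. Since L starts at z, the coefficient of z^n is the same in
  all partial sums \<open>P N\<close> with N \<ge> n, and the identity can be checked on these
  finite sums.\<close>

lemma exp_series_newton:
  fixes L :: "Qq symfun fps"
  assumes L: "fps_nth L 0 = 0"
  shows "newton (- (fps_X * fps_deriv L))
    (Abs_fps (\<lambda>n. \<Sum>j\<le>n. const_sf (1 / fact j) * fps_nth (L ^ j) n))"
proof -
  define H where "H = Abs_fps (\<lambda>n. \<Sum>j\<le>n. const_sf (1 / fact j) * fps_nth (L ^ j) n)"
  define P where "P N = (\<Sum>j\<le>N. fps_const (const_sf (1 / fact j)) * L ^ j)" for N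
  have H: "fps_nth H n = fps_nth (P N) n" if "n \<le> N" for n N
  proof -
    have "fps_nth (P N) n = (\<Sum>j\<le>N. const_sf (1 / fact j) * fps_nth (L ^ j) n)"
      by (simp add: P_def fps_sum_nth)
    also have "\<dots> = (\<Sum>j\<le>n. const_sf (1 / fact j) * fps_nth (L ^ j) n)"
      using that fps_power_nth_eq_0[OF L] by (intro sum.mono_neutral_right) auto
    finally show ?thesis by (simp add: H_def)
  qed
  have dP: "fps_deriv (P (Suc N)) = fps_deriv L * P N" for N
  proof -
    have "fps_deriv (fps_const c * L ^ j) = fps_const c * (of_nat j * fps_deriv L * L ^ (j - 1))" for c j
      by (simp add: fps_deriv_power fps_of_nat)
    then have "fps_deriv (P (Suc N)) =
        (\<Sum>j\<le>Suc N. fps_const (const_sf (1 / fact j)) * (of_nat j * fps_deriv L * L ^ (j - 1)))"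
      by (simp only: P_def fps_deriv_sum)
    also have "\<dots> = (\<Sum>j\<le>N. fps_const (const_sf (1 / fact (Suc j))) * (of_nat (Suc j) * fps_deriv L * L ^ j))"
      by (simp only: sum.atMost_Suc_shift diff_Suc_1 of_nat_0 mult_zero_left mult_zero_right add_0_left)
    also have "\<dots> = (\<Sum>j\<le>N. fps_deriv L * (fps_const (const_sf (1 / fact j)) * L ^ j))"
    proof (rule sum.cong)
      fix j
      have "1 / fact (Suc j) * of_nat (Suc j) = (1 / fact j :: Qq)"
        by (simp add: field_simps del: of_nat_Suc)
      then have "const_sf (1 / fact (Suc j)) * of_nat (Suc j) = const_sf (1 / fact j :: Qq)"
        by (metis const_sf_mult const_sf_of_nat)
      then have "fps_const (const_sf (1 / fact (Suc j))) * of_nat (Suc j) = fps_const (const_sf (1 / fact j :: Qq))"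
        by (metis fps_const_mult fps_of_nat)
      then have "fps_const (const_sf (1 / fact (Suc j))) * of_nat (Suc j) * (fps_deriv L * L ^ j) =
          fps_const (const_sf (1 / fact j :: Qq)) * (fps_deriv L * L ^ j)"
        by (simp only:)
      then show "fps_const (const_sf (1 / fact (Suc j))) * (of_nat (Suc j) * fps_deriv L * L ^ j) =
          fps_deriv L * (fps_const (const_sf (1 / fact j)) * L ^ j)"
        by (simp only: ac_simps)
    qed simp
    finally show ?thesis by (simp only: P_def sum_distrib_left)
  qed
  have "fps_deriv H = fps_deriv L * H"
  proof (rule fps_ext)
    fix n
    \<comment> \<open>The derivative reads coefficient n + 1 of H, which needs
      \<open>P (Suc n)\<close>; differentiation leads back to \<open>P n\<close>, still exact up to
      z^n.\<close>
    have "fps_nth (fps_deriv H) n = fps_nth (fps_deriv (P (Suc n))) n"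
      using H[of "Suc n" "Suc n"] by simp
    also have "\<dots> = fps_nth (fps_deriv L * H) n"
      unfolding dP fps_mult_nth by (intro sum.cong) (auto simp: H[of _ n])
    finally show "fps_nth (fps_deriv H) n = fps_nth (fps_deriv L * H) n" .
  qed
  moreover have "fps_nth H 0 = 1" by (simp add: H_def)
  ultimately show ?thesis by (simp add: newton_def H_def[symmetric] mult.assoc)
qed

text \<open>The coefficient of \<open>p\<^sub>k\<close> in \<open>p\<^sub>k[[u]\<^sub>t X]\<close>, and \<open>p\<^sub>k[M[u]\<^sub>q]\<close>.\<close>

definition beta :: "int \<Rightarrow> nat \<Rightarrow> Qq" where
  "beta u k = (1 - q powi (- u * int k)) / (1 - q powi (- int k))"

definition alpha :: "int \<Rightarrow> nat \<Rightarrow> Qq" where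
  "alpha u k = (1 - q powi (- int k)) * (1 - q powi (u * int k))"

lemma t_powi: "t powi n = q powi (- n)"
  by (simp add: t_def power_int_divide_distrib power_int_minus divide_inverse power_int_inverse)

lemma frob_q_t_powi: "k \<ge> 1 \<Longrightarrow> frob_q k (t powi n) = q powi (- n * int k)"
  using power_int_mult[of q "int k" "- n"]
  by (simp add: t_powi frob_q_powi frob_q_q mult.commute)

lemma frob_q_q_powi: "k \<ge> 1 \<Longrightarrow> frob_q k (q powi n) = q powi (n * int k)"
  using frob_q_t_powi[of k "- n"] by (simp add: t_powi)

lemma frob_q_qint_t: "k \<ge> 1 \<Longrightarrow> frob_q k (qint t u) = beta u k"
  using frob_q_t_powi[of k 1]
  by (simp add: qint_def beta_def frob_q_divide frob_q_diff frob_q_1 frob_q_t_powi)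

lemma q_neq_1 [simp]: "q \<noteq> 1"
  using q_power_neq_1[of 1] by simp

lemma frob_q_M_qint: "k \<ge> 1 \<Longrightarrow> frob_q k (M * qint q u) = alpha u k"
proof -
  assume k: "k \<ge> 1"
  have "M * qint q u = (1 - t) * (1 - q powi u)" by (simp add: M_def qint_def)
  then show ?thesis
    using k frob_q_t_powi[of k 1] by (simp add: alpha_def frob_q_mult frob_q_diff frob_q_1 frob_q_q_powi)
qed

text \<open>The series z d/dz of - log \<Omega>[- z [u]_t X].\<close>

definition omega_newton :: "int \<Rightarrow> Qq symfun fps" where
  "omega_newton u = Abs_fps (\<lambda>k. if k = 0 then 0 else const_sf (beta u k) * power_sum k)"

lemma of_nat_mult_const_sf: "n \<ge> 1 \<Longrightarrow> of_nat n * const_sf (1 / of_nat n :: Qq) = 1"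
  unfolding const_sf_of_nat[symmetric] const_sf_mult[symmetric] by simp

text \<open>p_k[- z [u]_t X] is concentrated in degree k, so only k = n survives in coefficient n of
  the logarithm. The derivative cancels the 1/n, and the sign is the one built into
  \<open>newton\<close>.\<close>

lemma newton_omega_series: "newton (omega_newton u) (omega_series u)"
proof -
  let ?L = "log_Omega (- (fls_X * cst (qint t u) * X))"
  have L: "fps_nth ?L n = const_sf (1 / of_nat n) * - (const_sf (beta u n) * power_sum n)" if "n \<ge> 1" for n
  proof -
    have "fps_nth ?L n = (\<Sum>k=1..n. if k = n then
        const_sf (1 / of_nat n) * - (const_sf (beta u n) * power_sum n) else 0)"
      unfolding log_Omega_def fps_nth_Abs_fps
      by (intro sum.cong) (auto simp: power_sum_pleth_neg_X frob_q_qint_t simp del: One_nat_def)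
    also have "\<dots> = const_sf (1 / of_nat n) * - (const_sf (beta u n) * power_sum n)"
      using that by simp
    finally show ?thesis .
  qed
  have "- (fps_X * fps_deriv ?L) = omega_newton u"
  proof (rule fps_ext)
    fix n
    show "fps_nth (- (fps_X * fps_deriv ?L)) n = fps_nth (omega_newton u) n"
    proof (cases n)
      case 0
      then show ?thesis by (simp add: omega_newton_def)
    next
      case (Suc m)
      then have "fps_nth (- (fps_X * fps_deriv ?L)) n = - (of_nat n * fps_nth ?L n)" by simp
      also have "\<dots> = of_nat n * const_sf (1 / of_nat n) * (const_sf (beta u n) * power_sum n)"
        using Suc by (subst L) (simp_all add: mult.assoc)
      also have "\<dots> = const_sf (beta u n) * power_sum n"
        using Suc by (subst of_nat_mult_const_sf) simp_all
      also have "\<dots> = fps_nth (omega_newton u) n" using Suc by (simp only: omega_newton_def fps_nth_Abs_fps) simp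
      finally show ?thesis .
    qed
  qed
  moreover have "fps_nth ?L 0 = 0" by (simp add: log_Omega_def)
  ultimately show ?thesis using exp_series_newton[of ?L] by (simp add: omega_series_def)
qed

lemma inverse_of_nat_symfun: "n > 0 \<Longrightarrow> \<exists>c :: Qq symfun. c * of_nat n = 1"
  using of_nat_mult_const_sf[of n] by (intro exI[of _ "const_sf (1 / of_nat n)"]) (simp add: mult.commute)

lemma inverse_of_nat_fls: "n > 0 \<Longrightarrow> \<exists>c :: Qq symfun fls. c * of_nat n = 1"
  using inverse_of_nat_symfun[of n] by (metis fls_const_1 fls_const_mult_const fls_of_nat)

text \<open>Solving the recursion for H_n takes only sums, products and a division by n.\<close>

lemma newton_psum_polys:
  assumes "newton B H" "\<And>k. fps_nth B k \<in> psum_polys"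
  shows "fps_nth H n \<in> psum_polys"
proof (induction n rule: less_induct)
  case (less n)
  show ?case
  proof (cases "n = 0")
    case True
    with assms show ?thesis by (simp add: newton_def psum_polys_1)
  next
    case False
    have 1: "fps_nth B i * fps_nth H (n - i) \<in> psum_polys" for i
      using less[of "n - i"] assms False by (cases "i = 0") (auto simp: newton_def intro: psum_polys_0 psum_polys_mult)
    have "fps_nth H n = const_sf (1 / of_nat n) * (of_nat n * fps_nth H n)"
    proof -
      have "const_sf (1 / of_nat n) * (of_nat n * fps_nth H n) =
          of_nat n * const_sf (1 / of_nat n) * fps_nth H n" by (simp only: ac_simps)
      also have "of_nat n * const_sf (1 / of_nat n :: Qq) = 1"
        using False by (intro of_nat_mult_const_sf) simp
      finally show ?thesis by simp
    qed
    also have "\<dots> = const_sf (1 / of_nat n) * - (\<Sum>i=0..n. fps_nth B i * fps_nth H (n - i))"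
      using assms(1) by (simp add: newton_nth)
    finally have "fps_nth H n = \<dots>" .
    moreover have "const_sf (1 / of_nat n) * - (\<Sum>i=0..n. fps_nth B i * fps_nth H (n - i)) \<in> psum_polys"
      by (intro psum_polys_mult psum_polys_const psum_polys_uminus psum_polys_sum 1)
    ultimately show ?thesis by (simp only:)
  qed
qed

lemma omega_series_psum_polys: "fps_nth (omega_series u) n \<in> psum_polys"
  using newton_omega_series by (rule newton_psum_polys) (auto simp: omega_newton_def psum_polys_0 psum_polys_mult psum_polys_const psum_polys_power_sum)

section \<open>The operators \<open>D\<close>\<close>

definition translate :: "int \<Rightarrow> Qq symfun \<Rightarrow> Qq symfun fls" where
  "translate u F = pleth F (X + cst (M * qint q u) * fls_X_inv)"

lemma D_eq: "D u v F = fls_nth (translate u F * fps_to_fls (omega_series u)) v"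
  by (simp add: D_def translate_def Omega_def omega_series_def)

lemma translate_power_sum: "k \<ge> 1 \<Longrightarrow> translate u (power_sum k) = fls_const (power_sum k) + cst (alpha u k) * fls_X_inv ^ k"
  by (simp only: translate_def pleth_power_sum power_sum_pleth_shift frob_q_M_qint)

lemma D_const: "D u v (const_sf a) = const_sf a * (if v \<ge> 0 then fps_nth (omega_series u) (nat v) else 0)"
  by (simp add: D_eq translate_def pleth_const)

lemma D_add: "F \<in> psum_polys \<Longrightarrow> G \<in> psum_polys \<Longrightarrow> D u v (F + G) = D u v F + D u v G"
  by (simp add: D_eq translate_def pleth_add distrib_right)

lemma D_const_mult: "F \<in> psum_polys \<Longrightarrow> D u v (const_sf a * F) = const_sf a * D u v F"
  by (simp add: D_eq translate_def pleth_mult[OF psum_polys_const] pleth_const mult.assoc)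

text \<open>The substitution sends p_k to p_k + \<open>alpha u k\<close> z^(-k), and a factor z^(-k)
  moves the extracted coefficient from z^v to z^(v+k). With the values on constants and additivity
  this determines D on \<open>psum_polys\<close>.\<close>

lemma D_power_sum_mult:
  assumes "k \<ge> 1" "F \<in> psum_polys"
  shows "D u v (power_sum k * F) = power_sum k * D u v F + const_sf (alpha u k) * D u (v + int k) F"
proof -
  have "translate u (power_sum k * F) = translate u (power_sum k) * translate u F"
    using assms by (simp add: translate_def pleth_mult psum_polys_power_sum)
  then have "translate u (power_sum k * F) * fps_to_fls (omega_series u) =
      fls_const (power_sum k) * (translate u F * fps_to_fls (omega_series u)) +
      cst (alpha u k) * (fls_X_inv ^ k * (translate u F * fps_to_fls (omega_series u)))"
    unfolding translate_power_sum[OF assms(1)] by (simp add: distrib_right mult.assoc)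
  then have "D u v (power_sum k * F) = fls_nth (fls_const (power_sum k) * (translate u F * fps_to_fls (omega_series u)) +
      cst (alpha u k) * (fls_X_inv ^ k * (translate u F * fps_to_fls (omega_series u)))) v"
    by (simp only: D_eq)
  also have "\<dots> = power_sum k * D u v F + const_sf (alpha u k) * D u (v + int k) F"
    unfolding fls_X_inv_power_times_conv_shift D_eq by simp
  finally show ?thesis .
qed

lemma D_psum_polys: "F \<in> psum_polys \<Longrightarrow> D u v F \<in> psum_polys"
proof (induction F arbitrary: v rule: psum_polys_induct)
  case (const a)
  show ?case by (simp add: D_const psum_polys_mult psum_polys_const psum_polys_0 omega_series_psum_polys)
next
  case (add F G)
  then show ?case by (simp add: D_add psum_polys_add)
next
  case (power_sum k F)
  then show ?case by (simp add: D_power_sum_mult psum_polys_add psum_polys_mult psum_polys_power_sum psum_polys_const)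
qed

text \<open>The analogue of \<open>newton_hom\<close> for a map known to be multiplicative and
  additive only on \<open>psum_polys\<close>.\<close>

lemma newton_pleth:
  assumes "newton B H" "\<And>n. fps_nth B n \<in> psum_polys" "\<And>n. fps_nth H n \<in> psum_polys"
  shows "newton (Abs_fps (\<lambda>n. pleth (fps_nth B n) E)) (Abs_fps (\<lambda>n. pleth (fps_nth H n) E))"
proof -
  have "of_nat n * pleth (fps_nth H n) E =
      - (\<Sum>i=0..n. pleth (fps_nth B i) E * pleth (fps_nth H (n - i)) E)" for n
  proof -
    have "of_nat n * pleth (fps_nth H n) E = cst (of_nat n) * pleth (fps_nth H n) E"
      by (simp add: const_sf_of_nat fls_of_nat)
    also have "\<dots> = pleth (const_sf (of_nat n) * fps_nth H n) E"
      by (simp only: pleth_mult[OF psum_polys_const assms(3)] pleth_const)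
    also have "const_sf (of_nat n) * fps_nth H n = - (\<Sum>i=0..n. fps_nth B i * fps_nth H (n - i))"
      using assms(1) by (simp add: newton_nth const_sf_of_nat)
    also have "pleth \<dots> E = - (\<Sum>i=0..n. pleth (fps_nth B i) E * pleth (fps_nth H (n - i)) E)"
      by (simp add: pleth_uminus psum_polys_sum psum_polys_mult assms pleth_sum pleth_mult)
    finally show ?thesis .
  qed
  with assms(1) pleth_const[of 0] pleth_const[of 1] show ?thesis by (simp add: newton_nth)
qed

section \<open>Partial fractions of the exchange factor\<close>

lemma linear_factors_identity:
  fixes a b c x :: "'a::comm_ring_1"
  assumes "c * (a - b) = - ((1 - a) * (1 - b))"
  shows "(1 - x) * (1 - a * b * x) = (1 - a * x) * (1 - b * x) + c * ((1 - b * x) - (1 - a * x))"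
proof -
  have "c * ((1 - b * x) - (1 - a * x)) = c * (a - b) * x" by (simp add: algebra_simps)
  then show ?thesis unfolding assms by (simp add: algebra_simps)
qed

lemma partial_fractions_identity:
  fixes a b c f g :: "'a::comm_ring_1"
  assumes "a * f = 1" "b * g = 1" "p = a * b + c * (b - a)"
  shows "p * (f * g) = 1 + c * (f - g)"
proof -
  have "p * (f * g) = (a * f) * (b * g) + c * ((b * g) * f - (a * f) * g)"
    unfolding assms(3) by (simp only: algebra_simps)
  then show ?thesis by (simp only: assms mult_1_left)
qed

text \<open>Expanding (1 - a^n) (1 - b^n) into four terms gives the logarithmic derivative of (1 -
  x) (1 - a b x) / ((1 - a x) (1 - b x)); for a \<noteq> b the poles are simple.\<close>

lemma newton_two_geometric:
  fixes a b :: "'a::field"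
  assumes "a \<noteq> b"
  shows "newton (Abs_fps (\<lambda>n. if n = 0 then 0 else (1 - a ^ n) * (1 - b ^ n)))
    (1 + fps_const ((1 - a) * (1 - b) / (b - a)) * (Abs_fps (\<lambda>n. a ^ n) - Abs_fps (\<lambda>n. b ^ n)))"
proof -
  let ?lin = "\<lambda>a. 1 - fps_const a * fps_X :: 'a fps"
  let ?G = "\<lambda>a. Abs_fps (\<lambda>n. a ^ n) :: 'a fps"
  let ?P = "\<lambda>a. Abs_fps (\<lambda>n. if n = 0 then 0 else a ^ n) :: 'a fps"
  let ?A = "(1 - a) * (1 - b) / (b - a)"
  have nw: "newton (?P 1 + ?P (a * b) + (- ?P a + - ?P b)) (?lin 1 * ?lin (a * b) * (?G a * ?G b))"
    by (intro newton_mult newton_linear newton_geometric)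
  have "?P 1 + ?P (a * b) + (- ?P a + - ?P b) =
      Abs_fps (\<lambda>n. if n = 0 then 0 else (1 - a ^ n) * (1 - b ^ n))"
    by (rule fps_ext) (simp add: algebra_simps power_mult_distrib)
  moreover have "?lin 1 * ?lin (a * b) * (?G a * ?G b) = 1 + fps_const ?A * (?G a - ?G b)"
  proof -
    \<comment> \<open>Comparing the coefficients of x in \<open>linear_factors_identity\<close>
      forces this value of the constant.\<close>
    have A: "?A * (a - b) = - ((1 - a) * (1 - b))"
      using assms by (simp add: field_simps)
    have "fps_const ?A * (fps_const a - fps_const b) = - ((1 - fps_const a) * (1 - fps_const b))"
      using arg_cong[OF A, of fps_const]
      by (simp only: fps_const_mult[symmetric] fps_const_sub[symmetric] fps_const_neg[symmetric] fps_const_1_eq_1)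
    from linear_factors_identity[OF this, of fps_X]
    have "?lin 1 * ?lin (a * b) = ?lin a * ?lin b + fps_const ?A * (?lin b - ?lin a)"
      by (simp add: mult.assoc)
    from partial_fractions_identity[OF geometric_mult geometric_mult this]
    show ?thesis .
  qed
  ultimately show ?thesis using nw by (simp only:)
qed

text \<open>The partial fraction coefficient (1 - a) (1 - b) / (b - a) at a = q^u, b = q^(-w). The
  form symmetric in u and w is \<open>comm_coeff_alt\<close>.\<close>

definition comm_coeff :: "int \<Rightarrow> int \<Rightarrow> Qq" where
  "comm_coeff u w = (1 - q powi u) * (1 - q powi (- w)) / (q powi (- w) - q powi u)"

lemma q_powi_inj: "q powi m = q powi n \<longleftrightarrow> m = n"
proof
  assume "q powi m = q powi n"
  then have "q powi (m - n) = 1" by (simp add: power_int_diff)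
  then show "m = n" using q_powi_neq_1[of "m - n"] by auto
qed simp

lemma comm_coeff_commute:
  assumes "u + w \<noteq> 0"
  shows "comm_coeff u w = comm_coeff w u"
proof -
  have ne: "q powi (- w) - q powi u \<noteq> 0" "q powi (- u) - q powi w \<noteq> 0"
    using assms by (auto simp: q_powi_inj)
  then show ?thesis
    unfolding comm_coeff_def frac_eq_eq[OF ne] by (simp add: power_int_minus field_simps)
qed

text \<open>
  \<open>\<Omega>[- M [u]\<^sub>q [w]\<^sub>t x]\<close> in partial fractions: it equals
  \<open>(1 - x) (1 - q\<^sup>u\<^sup>-\<^sup>w x) / ((1 - q\<^sup>u x) (1 - q\<^sup>-\<^sup>w x))\<close>.
\<close>

definition exchange_series :: "int \<Rightarrow> int \<Rightarrow> Qq fps" where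
  "exchange_series u w = 1 + fps_const (comm_coeff u w) * (Abs_fps (\<lambda>n. (q powi u) ^ n) - Abs_fps (\<lambda>n. (q powi (- w)) ^ n))"

lemma q_powi_power: "(q powi n) ^ k = q powi (n * int k)"
  by (simp only: power_int_mult power_int_of_nat)

lemma exchange_series_nth: "fps_nth (exchange_series u w) r =
  (if r = 0 then 1 else 0) + comm_coeff u w * (q powi (u * int r) - q powi (- w * int r))"
  by (simp add: exchange_series_def q_powi_power)

text \<open>The factor 1 - t^k contributed by M cancels the denominator of p_k[[w]_t]; the product
  is p_k[M [u]_q [w]_t].\<close>

lemma beta_alpha:
  assumes "k \<ge> 1"
  shows "beta w k * alpha u k = (1 - (q powi u) ^ k) * (1 - (q powi (- w)) ^ k)"
proof -
  have "1 - q powi (- int k) \<noteq> 0" using q_powi_neq_1[of "- int k"] assms by simp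
  then show ?thesis unfolding q_powi_power beta_def alpha_def by (simp add: field_simps)
qed

lemma newton_exchange_series:
  assumes "u + w \<noteq> 0"
  shows "newton (Abs_fps (\<lambda>k. if k = 0 then 0 else beta w k * alpha u k)) (exchange_series u w)"
proof -
  have "q powi u \<noteq> q powi (- w)" using assms by (auto simp: q_powi_inj)
  from newton_two_geometric[OF this]
  have "newton (Abs_fps (\<lambda>n. if n = 0 then 0 else (1 - (q powi u) ^ n) * (1 - (q powi (- w)) ^ n))) (exchange_series u w)"
    by (simp only: exchange_series_def comm_coeff_def)
  moreover have "Abs_fps (\<lambda>n. if n = 0 then 0 else (1 - (q powi u) ^ n) * (1 - (q powi (- w)) ^ n)) =
      Abs_fps (\<lambda>k. if k = 0 then 0 else beta w k * alpha u k)"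
    by (rule fps_ext) (simp add: beta_alpha)
  ultimately show ?thesis by simp
qed

text \<open>With a second variable y marking the index d, this is \<Omega>[- y [w]_t (X + M[u]_q /
  z)] = \<Omega>[- y [w]_t X] \<Omega>[- M [u]_q [w]_t y/z], where the last factor is the exchange
  series at x = y/z. Both sides are series in y over Laurent series in z with the same Newton
  recursion.\<close>

lemma translate_omega_series:
  assumes "u + w \<noteq> 0"
  shows "translate u (fps_nth (omega_series w) d) =
    (\<Sum>r=0..d. fls_X_inv ^ r * fls_const (const_sf (fps_nth (exchange_series u w) r) * fps_nth (omega_series w) (d - r)))"
proof -
  let ?E = "X + cst (M * qint q u) * fls_X_inv"
  let ?B = "Abs_fps (\<lambda>k. fls_X_inv ^ k * fps_nth (Abs_fps (\<lambda>n. cst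
    (fps_nth (Abs_fps (\<lambda>k. if k = 0 then 0 else beta w k * alpha u k)) n))) k)"
  let ?R = "Abs_fps (\<lambda>k. fls_X_inv ^ k * fps_nth (Abs_fps (\<lambda>n. cst (fps_nth (exchange_series u w) n))) k)"
  have omega_newton: "fps_nth (omega_newton w) n \<in> psum_polys" for n
    by (simp add: omega_newton_def psum_polys_0 psum_polys_mult psum_polys_const psum_polys_power_sum)
  have 1: "newton (Abs_fps (\<lambda>n. pleth (fps_nth (omega_newton w) n) ?E)) (Abs_fps (\<lambda>n. pleth (fps_nth (omega_series w) n) ?E))"
    by (rule newton_pleth[OF newton_omega_series omega_newton omega_series_psum_polys])
  have 2: "newton ?B ?R"
    by (intro newton_scale newton_hom newton_exchange_series assms)
      (simp_all add: const_sf_add const_sf_mult fls_plus_const[symmetric])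
  have 3: "newton (Abs_fps (\<lambda>n. fls_const (fps_nth (omega_newton w) n))) (Abs_fps (\<lambda>n. fls_const (fps_nth (omega_series w) n)))"
    by (intro newton_hom newton_omega_series) (simp_all add: fls_plus_const[symmetric])
  have "Abs_fps (\<lambda>n. pleth (fps_nth (omega_newton w) n) ?E) = ?B + Abs_fps (\<lambda>n. fls_const (fps_nth (omega_newton w) n))"
  proof (rule fps_ext)
    fix n
    show "fps_nth (Abs_fps (\<lambda>n. pleth (fps_nth (omega_newton w) n) ?E)) n =
        fps_nth (?B + Abs_fps (\<lambda>n. fls_const (fps_nth (omega_newton w) n))) n"
    proof (cases "n = 0")
      case True
      then show ?thesis using pleth_const[of 0] by (simp add: omega_newton_def)
    next
      case False
      then have n: "n \<ge> 1" by simp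
      have "pleth (fps_nth (omega_newton w) n) ?E = cst (beta w n) * translate u (power_sum n)"
        using False by (simp add: omega_newton_def translate_def pleth_mult psum_polys_const psum_polys_power_sum pleth_const)
      also have "\<dots> = fls_const (fps_nth (omega_newton w) n) + fls_X_inv ^ n * cst (beta w n * alpha u n)"
        unfolding translate_power_sum[OF n] using False
        by (simp add: omega_newton_def distrib_left const_sf_mult fls_const_mult_const[symmetric] ac_simps del: fls_const_mult_const)
      finally show ?thesis using False by simp
    qed
  qed
  with newton_mult[OF 2 3]
  have "newton (Abs_fps (\<lambda>n. pleth (fps_nth (omega_newton w) n) ?E)) (?R * Abs_fps (\<lambda>n. fls_const (fps_nth (omega_series w) n)))"
    by (simp only:)
  from newton_unique[OF 1 this inverse_of_nat_fls]
  have "fps_nth (Abs_fps (\<lambda>n. pleth (fps_nth (omega_series w) n) ?E)) d =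
      fps_nth (?R * Abs_fps (\<lambda>n. fls_const (fps_nth (omega_series w) n))) d" by (simp only:)
  then show ?thesis by (simp add: fps_mult_nth translate_def mult.assoc)
qed

lemma D_omega_series:
  assumes "u + w \<noteq> 0"
  shows "D u (int b) (fps_nth (omega_series w) d) =
    (\<Sum>r=0..d. const_sf (fps_nth (exchange_series u w) r) * fps_nth (omega_series w) (d - r) * fps_nth (omega_series u) (b + r))"
proof -
  have "fls_nth (fls_X_inv ^ r * fls_const c * fps_to_fls (omega_series u)) (int b) = c * fps_nth (omega_series u) (b + r)" for r c
  proof -
    have "fls_X_inv ^ r * fls_const c * fps_to_fls (omega_series u) = fls_const c * (fls_X_inv ^ r * fps_to_fls (omega_series u))"
      by (simp only: ac_simps)
    then show ?thesis
      by (simp add: fls_X_inv_power_times_conv_shift nat_add_distrib)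
  qed
  then show ?thesis
    by (simp only: D_eq translate_omega_series[OF assms] sum_distrib_right fls_nth_sum)
qed

section \<open>Additivity of \<open>omega_series\<close> in its index\<close>

lemma beta_add: "beta (u + w) k = beta u k + q powi (- u * int k) * beta w k"
proof -
  have "q powi (- (u + w) * int k) = q powi (- u * int k) * q powi (- w * int k)"
    by (simp add: power_int_add[symmetric] algebra_simps)
  then show ?thesis
    by (simp add: beta_def add_divide_distrib[symmetric] algebra_simps)
qed

text \<open>Since [u+w]_t = [u]_t + t^u [w]_t, the series splits into the one for u and the one for
  w taken at t^u z.\<close>

lemma omega_series_add:
  "fps_nth (omega_series (u + w)) n =
    (\<Sum>j=0..n. const_sf (q powi (- u * int j)) * fps_nth (omega_series w) j * fps_nth (omega_series u) (n - j))"
proof -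
  let ?c = "const_sf (q powi (- u))"
  have 1: "newton (Abs_fps (\<lambda>k. ?c ^ k * fps_nth (omega_newton w) k) + omega_newton u) (Abs_fps (\<lambda>k. ?c ^ k * fps_nth (omega_series w) k) * omega_series u)"
    by (intro newton_mult newton_scale newton_omega_series)
  have c: "?c ^ k = const_sf (q powi (- u * int k))" for k
    by (simp only: const_sf_power[symmetric] power_int_mult power_int_of_nat)
  have "Abs_fps (\<lambda>k. ?c ^ k * fps_nth (omega_newton w) k) + omega_newton u = omega_newton (u + w)"
    unfolding c by (rule fps_ext) (simp add: omega_newton_def beta_add const_sf_add const_sf_mult algebra_simps)
  with 1 have "newton (omega_newton (u + w)) (Abs_fps (\<lambda>k. ?c ^ k * fps_nth (omega_series w) k) * omega_series u)" by (simp only:)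
  from newton_unique[OF newton_omega_series this inverse_of_nat_symfun]
  show ?thesis unfolding c by (simp only:) (simp add: fps_mult_nth)
qed

text \<open>The same decomposition with u and w exchanged, reindexed so that the products agree with
  those of \<open>omega_series_add\<close> and only the weights differ. The commutator is a
  difference of the two forms.\<close>

lemma omega_series_add':
  "fps_nth (omega_series (u + w)) n =
    (\<Sum>j=0..n. const_sf (q powi (- w * int (n - j))) * fps_nth (omega_series w) j * fps_nth (omega_series u) (n - j))"
proof -
  have "fps_nth (omega_series (u + w)) n =
      (\<Sum>j=0..n. const_sf (q powi (- w * int j)) * fps_nth (omega_series u) j * fps_nth (omega_series w) (n - j))"
    using omega_series_add[of w u n] by (simp add: add.commute)
  also have "\<dots> = (\<Sum>j=0..n. const_sf (q powi (- w * int (n - j))) * fps_nth (omega_series w) j * fps_nth (omega_series u) (n - j))"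
    by (rule sum.reindex_bij_witness[of _ "\<lambda>j. n - j" "\<lambda>j. n - j"]) (auto simp: ac_simps)
  finally show ?thesis .
qed

section \<open>Elementary symmetric functions\<close>

text \<open>Only k = c and k = c - 1 contribute, with opposite signs; for c = 1 the second lies
  outside the range and nothing cancels.\<close>

lemma alternating_sum_top_two:
  assumes "1 \<le> c" "c \<le> n"
  shows "(\<Sum>k=1..c. (-1) ^ (n - k) * (if c - k \<le> 1 then 1 else 0)) =
    (if c = 1 then (-1) ^ (n - 1) else (0 :: 'a::comm_ring_1))"
proof (cases "c = 1")
  case True
  then show ?thesis by simp
next
  case False
  then obtain d where d: "c = Suc (Suc d)" using assms by (metis One_nat_def Suc_le_D not0_implies_Suc not_one_le_zero)
  have "(\<Sum>k=1..c. (-1) ^ (n - k) * (if c - k \<le> 1 then 1 else 0 :: 'a)) =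
      (\<Sum>k\<in>{Suc d, Suc (Suc d)}. (-1) ^ (n - k) * (if c - k \<le> 1 then 1 else 0))"
    by (rule sum.mono_neutral_right) (auto simp: d)
  also have "\<dots> = (-1) ^ (n - Suc d) + (-1) ^ (n - Suc (Suc d))" by (simp add: d)
  also have "n - Suc d = Suc (n - Suc (Suc d))" using assms d by simp
  finally show ?thesis using False by simp
qed

lemma coeff_elem_sym:
  "coeff_sf (elem_sym n) m = (if size m = n \<and> (\<forall>i. count m i \<le> 1) then 1 else 0)"
  by (simp add: elem_sym.rep_eq)

lemma coeff_minus_one_power_mult: "coeff_sf ((-1) ^ j * F) m = (-1) ^ j * coeff_sf F m"
  using coeff_const_sf_mult[of "(-1) ^ j" F m] by (simp add: const_sf_power const_sf_uminus)

text \<open>Exchange the sums over k and over the variable i: removing x_i^k must leave a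
  square-free monomial, and for fixed i the possible k cancel in pairs unless x_i has exponent 1. A
  square-free m gets one contribution from each of its n variables.\<close>

lemma coeff_power_sum_elem_sym_sum:
  assumes "size m = n"
  shows "(\<Sum>k=1..n. (-1) ^ (n - k) * coeff_sf (power_sum k * elem_sym (n - k) :: 'a::comm_ring_1 symfun) m) =
    (if \<forall>i. count m i \<le> 1 then of_nat n * (-1) ^ (n - 1) else 0)"
proof -
  define sqfree where "sqfree \<longleftrightarrow> (\<forall>i. count m i \<le> 1)"
  have c_le: "count m i \<le> n" for i using assms count_le_size[of m i] by simp
  let ?f = "\<lambda>k i. (-1) ^ (n - k) * coeff_sf (elem_sym (n - k) :: 'a symfun) (m - replicate_mset k i)"
  have inner: "(\<Sum>k=1..count m i. ?f k i) = (if sqfree then (-1) ^ (n - 1) else 0)" if i: "i \<in># m" for i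
  proof -
    have c: "1 \<le> count m i" using i by (simp add: Suc_le_eq)
    have "(\<Sum>k=1..count m i. ?f k i) = (\<Sum>k=1..count m i.
        (if \<forall>j. j \<noteq> i \<longrightarrow> count m j \<le> 1 then 1 else 0) *
        ((-1) ^ (n - k) * (if count m i - k \<le> 1 then 1 else 0)))"
    proof (rule sum.cong[OF refl])
      fix k assume "k \<in> {1..count m i}"
      then have "replicate_mset k i \<subseteq># m"
        using count_le_replicate_mset_subset_eq[of k m i] by simp
      then have "size (m - replicate_mset k i) = n - k"
        using assms by (simp add: size_Diff_submset)
      moreover have "(\<forall>j. count (m - replicate_mset k i) j \<le> 1) \<longleftrightarrow>
          (\<forall>j. j \<noteq> i \<longrightarrow> count m j \<le> 1) \<and> count m i - k \<le> 1"
        by (auto split: if_splits)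
      ultimately show "?f k i = (if \<forall>j. j \<noteq> i \<longrightarrow> count m j \<le> 1 then 1 else 0) *
          ((-1) ^ (n - k) * (if count m i - k \<le> 1 then 1 else 0))"
        by (auto simp: coeff_elem_sym)
    qed
    also have "\<dots> = (if \<forall>j. j \<noteq> i \<longrightarrow> count m j \<le> 1 then 1 else 0) *
        (if count m i = 1 then (-1) ^ (n - 1) else 0)"
      by (simp only: sum_distrib_left[symmetric] alternating_sum_top_two[OF c c_le])
    also have "\<dots> = (if sqfree then (-1) ^ (n - 1) else 0)"
    proof -
      have "sqfree \<longleftrightarrow> (\<forall>j. j \<noteq> i \<longrightarrow> count m j \<le> 1) \<and> count m i = 1"
        unfolding sqfree_def using c by (metis le_antisym order_refl)
      then show ?thesis by auto
    qed
    finally show ?thesis .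
  qed
  have "(\<Sum>k=1..n. (-1) ^ (n - k) * coeff_sf (power_sum k * elem_sym (n - k) :: 'a symfun) m) =
      (\<Sum>k=1..n. \<Sum>i | i \<in># m \<and> k \<le> count m i. ?f k i)"
    by (intro sum.cong) (simp_all add: coeff_power_sum_mult sum_distrib_left)
  also have "\<dots> = (\<Sum>i\<in>set_mset m. \<Sum>k | k \<in> {1..n} \<and> k \<le> count m i. ?f k i)"
    using sum.swap_restrict[of "{1..n}" "set_mset m" ?f "\<lambda>k i. k \<le> count m i"] by simp
  also have "\<dots> = (\<Sum>i\<in>set_mset m. \<Sum>k=1..count m i. ?f k i)"
  proof (rule sum.cong[OF refl])
    fix i
    have "{k. k \<in> {1..n} \<and> k \<le> count m i} = {1..count m i}"
      using c_le[of i] by auto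
    then show "(\<Sum>k | k \<in> {1..n} \<and> k \<le> count m i. ?f k i) = (\<Sum>k=1..count m i. ?f k i)" by simp
  qed
  also have "\<dots> = (\<Sum>i\<in>set_mset m. if sqfree then (-1) ^ (n - 1) else 0)"
    by (intro sum.cong inner) simp_all
  also have "\<dots> = (if sqfree then of_nat n * (-1) ^ (n - 1) else 0)"
  proof (cases sqfree)
    case True
    have "size m = (\<Sum>i\<in>set_mset m. count m i)" by (rule size_multiset_overloaded_eq)
    also have "\<dots> = (\<Sum>i\<in>set_mset m. 1)"
    proof (rule sum.cong[OF refl])
      fix i assume "i \<in> set_mset m"
      then have "count m i \<ge> 1" by (simp add: Suc_le_eq)
      moreover have "count m i \<le> 1" using True unfolding sqfree_def by blast
      ultimately show "count m i = 1" by (intro antisym)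
    qed
    finally show ?thesis using True assms by simp
  qed simp
  finally show ?thesis by (simp only: sqfree_def)
qed

text \<open>Newton's identities for the product of the 1 - z x_i, which is \<Omega>[- z X]. Both
  sides are homogeneous of degree n, so only monomials of size n matter.\<close>

lemma newton_elem_sym:
  "newton (Abs_fps (\<lambda>k. if k = 0 then 0 else power_sum k))
    (Abs_fps (\<lambda>n. (-1) ^ n * elem_sym n) :: 'a::comm_ring_1 symfun fps)"
proof -
  have "of_nat n * ((-1) ^ n * elem_sym n) =
      - (\<Sum>k=0..n. (if k = 0 then 0 else power_sum k) * ((-1) ^ (n - k) * elem_sym (n - k)) :: 'a symfun)"
    (is "?l = - ?r") for n
  proof (rule symfun_eqI)
    fix m
    have l: "coeff_sf ?l m = of_nat n * ((-1) ^ n * coeff_sf (elem_sym n) m)"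
      using coeff_const_sf_mult[of "of_nat n :: 'a" "(-1) ^ n * elem_sym n" m]
      by (simp add: const_sf_of_nat coeff_minus_one_power_mult)
    have "?r = (\<Sum>k=1..n. (-1) ^ (n - k) * (power_sum k * elem_sym (n - k)))"
      by (rule sum.mono_neutral_cong_right) (auto simp: ac_simps)
    then have r: "coeff_sf ?r m =
        (\<Sum>k=1..n. (-1) ^ (n - k) * coeff_sf (power_sum k * elem_sym (n - k)) m)"
      by (simp only: coeff_sum_sf coeff_minus_one_power_mult)
    show "coeff_sf ?l m = coeff_sf (- ?r) m"
    proof (cases "size m = n")
      case True
      then have "coeff_sf ?r m = (if \<forall>i. count m i \<le> 1 then of_nat n * (-1) ^ (n - 1) else 0)"
        unfolding r by (rule coeff_power_sum_elem_sym_sum)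
      \<comment> \<open>For n = 0 the truncated exponent n - 1 is harmless, as the factor
        \<open>of_nat n\<close> vanishes.\<close>
      then show ?thesis
        unfolding l uminus_symfun.rep_eq coeff_elem_sym using True by (cases n) simp_all
    next
      case False
      have "coeff_sf (power_sum k * elem_sym (n - k) :: 'a symfun) m = 0" if k: "k \<in> {1..n}" for k
      proof -
        have "coeff_sf (elem_sym (n - k) :: 'a symfun) (m - replicate_mset k i) = 0" if "k \<le> count m i" for i
        proof -
          have "replicate_mset k i \<subseteq># m" "k \<le> size m"
            using that count_le_replicate_mset_subset_eq[of k m i] count_le_size[of m i] by simp_all
          moreover from this have "size (m - replicate_mset k i) = size m - k"
            by (simp add: size_Diff_submset)
          ultimately have "size (m - replicate_mset k i) \<noteq> n - k" using False k by auto
          then show ?thesis by (simp add: coeff_elem_sym)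
        qed
        moreover have "1 \<le> k" using k by simp
        ultimately show ?thesis by (simp add: coeff_power_sum_mult)
      qed
      then have "coeff_sf ?r m = 0" unfolding r by simp
      then show ?thesis unfolding l uminus_symfun.rep_eq coeff_elem_sym using False by simp
    qed
  qed
  then show ?thesis by (simp add: newton_nth coeff_elem_sym symfun_eqI one_symfun.rep_eq)
qed

section \<open>The commutator of the operators \<open>D\<close>\<close>

text \<open>The exchange coefficients for (u,w) at r are g(r), those for (w,u) are - g(-r), apart
  from the term 1 at r = 0, which cancels in the difference. The two finite sums are therefore the
  parts j \<le> d and j > d of one sum over all j, which \<open>omega_series_add\<close>
  evaluates.\<close>

lemma D_commutator_1:
  assumes uw: "u + w \<noteq> 0"
  shows "D u (int b) (fps_nth (omega_series w) d) - D w (int d) (fps_nth (omega_series u) b) =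
    const_sf (comm_coeff u w * (q powi (u * int d) - q powi (w * int b))) * fps_nth (omega_series (u + w)) (b + d)"
proof -
  define g where "g x = comm_coeff u w * (q powi (u * x) - q powi (- w * x))" for x :: int
  define f where "f j = const_sf (g (int d - int j)) * fps_nth (omega_series w) j * fps_nth (omega_series u) (b + d - j)" for j
  let ?hh = "fps_nth (omega_series w) d * fps_nth (omega_series u) b"
  have "D u (int b) (fps_nth (omega_series w) d) = (\<Sum>r=0..d. (if r = 0 then ?hh else 0) + f (d - r))"
    unfolding D_omega_series[OF uw]
  proof (rule sum.cong[OF refl])
    fix r assume "r \<in> {0..d}"
    then have "int d - int (d - r) = int r" "b + d - (d - r) = b + r" by auto
    then show "const_sf (fps_nth (exchange_series u w) r) * fps_nth (omega_series w) (d - r) * fps_nth (omega_series u) (b + r) =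
        (if r = 0 then ?hh else 0) + f (d - r)"
      by (simp add: f_def g_def exchange_series_nth)
  qed
  also have "\<dots> = ?hh + (\<Sum>r=0..d. f (d - r))"
    by (simp add: sum.distrib)
  also have "(\<Sum>r=0..d. f (d - r)) = (\<Sum>j=0..d. f j)"
    by (rule sum.reindex_bij_witness[of _ "\<lambda>j. d - j" "\<lambda>j. d - j"]) auto
  finally have 1: "D u (int b) (fps_nth (omega_series w) d) = ?hh + (\<Sum>j=0..d. f j)" .
  have wu: "w + u \<noteq> 0" using uw by simp
  have "D w (int d) (fps_nth (omega_series u) b) = (\<Sum>r=0..b. (if r = 0 then ?hh else 0) - f (d + r))"
    unfolding D_omega_series[OF wu]
  proof (rule sum.cong[OF refl])
    fix r assume "r \<in> {0..b}"
    then have "int d - int (d + r) = - int r" "b + d - (d + r) = b - r" by auto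
    then show "const_sf (fps_nth (exchange_series w u) r) * fps_nth (omega_series u) (b - r) * fps_nth (omega_series w) (d + r) =
        (if r = 0 then ?hh else 0) - f (d + r)"
      by (simp add: f_def g_def exchange_series_nth comm_coeff_commute[OF wu])
        (simp add: right_diff_distrib const_sf_diff algebra_simps)
  qed
  also have "\<dots> = ?hh - (\<Sum>r=0..b. f (d + r))"
    by (simp add: sum_subtractf)
  \<comment> \<open>g(0) = 0, so the term j = d common to both ranges may be dropped from one of
    them.\<close>
  also have "(\<Sum>r=0..b. f (d + r)) = (\<Sum>r=1..b. f (d + r))"
    by (rule sum.mono_neutral_right) (auto simp: f_def g_def not_less_eq_eq)
  also have "\<dots> = (\<Sum>j=Suc d..d + b. f j)"
    by (rule sum.reindex_bij_witness[of _ "\<lambda>j. j - d" "\<lambda>r. d + r"]) auto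
  finally have 2: "D w (int d) (fps_nth (omega_series u) b) = ?hh - (\<Sum>j=Suc d..d + b. f j)" .
  have "(\<Sum>j=0..d. f j) + (\<Sum>j=Suc d..d + b. f j) = (\<Sum>j=0..d + b. f j)"
    using sum.ub_add_nat[of 0 d f b] by simp
  with 1 2 have "D u (int b) (fps_nth (omega_series w) d) - D w (int d) (fps_nth (omega_series u) b) = (\<Sum>j=0..b + d. f j)"
    by (simp add: add.commute)
  \<comment> \<open>The two exponentials of g are split as u (d - j) = u d - u j and - w (d - j) = w
    b - w (b + d - j), which are the weights of \<open>omega_series_add\<close> and
    \<open>omega_series_add'\<close>.\<close>
  also have "\<dots> = (\<Sum>j=0..b + d.
      const_sf (comm_coeff u w * q powi (u * int d)) *
        (const_sf (q powi (- u * int j)) * fps_nth (omega_series w) j * fps_nth (omega_series u) (b + d - j)) -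
      const_sf (comm_coeff u w * q powi (w * int b)) *
        (const_sf (q powi (- w * int (b + d - j))) * fps_nth (omega_series w) j * fps_nth (omega_series u) (b + d - j)))"
  proof (rule sum.cong[OF refl])
    fix j assume j: "j \<in> {0..b + d}"
    have "g (int d - int j) = comm_coeff u w * q powi (u * int d) * q powi (- u * int j) -
        comm_coeff u w * q powi (w * int b) * q powi (- w * int (b + d - j))"
    proof -
      have "u * int d + - u * int j = u * (int d - int j)"
        "w * int b + - w * int (b + d - j) = - w * (int d - int j)"
        using j by (simp_all add: of_nat_diff algebra_simps)
      then have "q powi (u * int d) * q powi (- u * int j) = q powi (u * (int d - int j))"
        "q powi (w * int b) * q powi (- w * int (b + d - j)) = q powi (- w * (int d - int j))"
        by (simp_all only: power_int_add[symmetric] q_nonzero simp_thms)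
      then show ?thesis by (simp only: g_def right_diff_distrib mult.assoc)
    qed
    then show "f j = const_sf (comm_coeff u w * q powi (u * int d)) *
        (const_sf (q powi (- u * int j)) * fps_nth (omega_series w) j * fps_nth (omega_series u) (b + d - j)) -
      const_sf (comm_coeff u w * q powi (w * int b)) *
        (const_sf (q powi (- w * int (b + d - j))) * fps_nth (omega_series w) j * fps_nth (omega_series u) (b + d - j))"
      unfolding f_def by (simp only: const_sf_diff const_sf_mult left_diff_distrib mult.assoc)
  qed
  also have "\<dots> = const_sf (comm_coeff u w * q powi (u * int d)) * fps_nth (omega_series (u + w)) (b + d) -
      const_sf (comm_coeff u w * q powi (w * int b)) * fps_nth (omega_series (u + w)) (b + d)"
    by (simp only: sum_subtractf sum_distrib_left[symmetric] omega_series_add[symmetric] omega_series_add'[symmetric])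
  finally show ?thesis
    by (simp only: right_diff_distrib const_sf_diff left_diff_distrib)
qed

text \<open>Up to the common factor 1 - q^(-k) this is (1 - A) (x - y B) + (1 - B) (x A - y) = (1 -
  A B) (x - y) with A = q^(uk), B = q^(wk), x = q^(ud), y = q^(wb). It is the consistency condition
  for multiplying by p_k in the commutator formula.\<close>

lemma alpha_identity:
  "alpha u k * (q powi (u * d) - q powi (w * (b + int k))) +
   alpha w k * (q powi (u * (d + int k)) - q powi (w * b)) =
   alpha (u + w) k * (q powi (u * d) - q powi (w * b))"
proof -
  have "q powi (w * (b + int k)) = q powi (w * b) * q powi (w * int k)"
    "q powi (u * (d + int k)) = q powi (u * d) * q powi (u * int k)"
    "q powi ((u + w) * int k) = q powi (u * int k) * q powi (w * int k)"
    by (simp_all only: distrib_left distrib_right power_int_add q_nonzero simp_thms)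
  then show ?thesis unfolding alpha_def by (simp add: algebra_simps)
qed

text \<open>
  By \<open>D_power_sum_mult\<close> the commutator of \<open>D\<^bsub>u,b\<^esub>\<close> with multiplication by \<open>p\<^sub>k\<close> is a multiple of
  \<open>D\<^bsub>u,b+k\<^esub>\<close>; so both sides change in the same way when \<open>F\<close> is multiplied by \<open>p\<^sub>k\<close>, and only
  \<open>F = 1\<close> needs a computation.
\<close>

lemma D_commutator_nat:
  assumes uw: "u + w \<noteq> 0" and "F \<in> psum_polys"
  shows "D u (int b) (D w (int d) F) - D w (int d) (D u (int b) F) =
    const_sf (comm_coeff u w * (q powi (u * int d) - q powi (w * int b))) * D (u + w) (int (b + d)) F"
  using assms(2)
proof (induction F arbitrary: b d rule: psum_polys_induct)
  case (const a)
  have "D u (int b) (D w (int d) (const_sf a)) - D w (int d) (D u (int b) (const_sf a)) =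
      const_sf a * (D u (int b) (fps_nth (omega_series w) d) - D w (int d) (fps_nth (omega_series u) b))"
    by (simp add: D_const D_const_mult[OF omega_series_psum_polys] right_diff_distrib)
  also have "\<dots> = const_sf a * (const_sf (comm_coeff u w * (q powi (u * int d) - q powi (w * int b))) *
      fps_nth (omega_series (u + w)) (b + d))"
    by (simp only: D_commutator_1[OF uw])
  also have "\<dots> = const_sf (comm_coeff u w * (q powi (u * int d) - q powi (w * int b))) *
      D (u + w) (int (b + d)) (const_sf a)"
    by (simp add: D_const nat_add_distrib ac_simps)
  finally show ?case .
next
  case (add F G)
  have "D u (int b) (D w (int d) (F + G)) - D w (int d) (D u (int b) (F + G)) =
      (D u (int b) (D w (int d) F) - D w (int d) (D u (int b) F)) +
      (D u (int b) (D w (int d) G) - D w (int d) (D u (int b) G))"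
    using add.hyps by (simp add: D_add D_psum_polys)
  then show ?case
    using add.hyps unfolding add.IH by (simp only: D_add distrib_left)
next
  case (power_sum k F)
  let ?C = "\<lambda>b d. D u (int b) (D w (int d) F) - D w (int d) (D u (int b) F)"
  let ?c = "\<lambda>b d. comm_coeff u w * (q powi (u * int d) - q powi (w * int b))"
  note k = power_sum.hyps(1) and F = power_sum.hyps(2)
  have exp: "D u (int b) (D w (int d) (power_sum k * F)) =
      power_sum k * D u (int b) (D w (int d) F) +
      const_sf (alpha u k) * D u (int (b + k)) (D w (int d) F) +
      const_sf (alpha w k) * D u (int b) (D w (int (d + k)) F)" for u w b d
  proof -
    have "D u (int b) (D w (int d) (power_sum k * F)) =
        D u (int b) (power_sum k * D w (int d) F + const_sf (alpha w k) * D w (int (d + k)) F)"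
      unfolding D_power_sum_mult[OF k F] of_nat_add ..
    also have "\<dots> = D u (int b) (power_sum k * D w (int d) F) +
        D u (int b) (const_sf (alpha w k) * D w (int (d + k)) F)"
      by (intro D_add psum_polys_mult psum_polys_power_sum psum_polys_const D_psum_polys k F)
    finally show ?thesis
      by (simp add: D_power_sum_mult[OF k D_psum_polys[OF F]] D_const_mult[OF D_psum_polys[OF F]])
  qed
  have "D u (int b) (D w (int d) (power_sum k * F)) - D w (int d) (D u (int b) (power_sum k * F)) =
      power_sum k * ?C b d + const_sf (alpha u k) * ?C (b + k) d + const_sf (alpha w k) * ?C b (d + k)"
    unfolding exp by (simp add: algebra_simps)
  also have "\<dots> = power_sum k * (const_sf (?c b d) * D (u + w) (int (b + d)) F) +
      const_sf (alpha u k * ?c (b + k) d + alpha w k * ?c b (d + k)) * D (u + w) (int (b + d + k)) F"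
  proof -
    have idx: "b + k + d = b + d + k" "b + (d + k) = b + d + k" by simp_all
    show ?thesis
      unfolding power_sum.IH idx by (simp only: const_sf_add const_sf_mult distrib_right mult.assoc add.assoc)
  qed
  also have "alpha u k * ?c (b + k) d + alpha w k * ?c b (d + k) =
      comm_coeff u w * (alpha u k * (q powi (u * int d) - q powi (w * (int b + int k))) +
        alpha w k * (q powi (u * (int d + int k)) - q powi (w * int b)))"
    by (simp only: of_nat_add distrib_left ac_simps)
  also have "\<dots> = comm_coeff u w * (alpha (u + w) k * (q powi (u * int d) - q powi (w * int b)))"
    by (simp only: alpha_identity)
  also have "\<dots> = ?c b d * alpha (u + w) k"
    by (simp only: ac_simps)
  also have "power_sum k * (const_sf (?c b d) * D (u + w) (int (b + d)) F) +
      const_sf (?c b d * alpha (u + w) k) * D (u + w) (int (b + d + k)) F =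
      const_sf (?c b d) * D (u + w) (int (b + d)) (power_sum k * F)"
    unfolding D_power_sum_mult[OF k F] const_sf_mult[of "?c b d"] of_nat_add[of "b + d" k]
    by (simp only: distrib_left ac_simps)
  finally show ?case .
qed

lemma D_commutator:
  assumes "u + w \<noteq> 0" "F \<in> psum_polys" "b \<ge> 0" "d \<ge> 0"
  shows "D u b (D w d F) - D w d (D u b F) =
    const_sf (comm_coeff u w * (q powi (u * d) - q powi (w * b))) * D (u + w) (b + d) F"
  using D_commutator_nat[OF assms(1,2), of "nat b" "nat d"] assms(3,4) by simp

section \<open>The operators \<open>Q\<^sup>s\<close>\<close>

lemma qint_t: "qint t u = (1 - q powi (- u)) / (1 - t)"
  by (simp add: qint_def t_powi)

lemma comm_coeff_alt:
  assumes "u + w \<noteq> 0"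
  shows "comm_coeff u w = (1 - q powi (- u)) * (1 - q powi (- w)) / (1 - q powi (- (u + w)))"
proof -
  have "q powi (- w) - q powi u \<noteq> 0" "1 - q powi (- (u + w)) \<noteq> 0"
    using assms q_powi_neq_1[of "- (u + w)"] by (auto simp: q_powi_inj)
  moreover have "q powi (- (u + w)) = q powi (- u) * q powi (- w)"
    by (simp add: power_int_add[symmetric])
  moreover have "q powi u * q powi (- u) = 1"
    by (simp add: power_int_add[symmetric])
  ultimately show ?thesis unfolding comm_coeff_def frac_eq_eq
    by (simp add: field_simps power_int_minus)
qed

lemma t_neq_1: "t \<noteq> 1"
  by (simp add: t_def)

text \<open>By \<open>comm_coeff_alt\<close> the factors 1 - q^(-u) and 1 - q^(-w) cancel against
  [u]_t and [w]_t. The difference of powers is q^(ub) (1 - q^g), and dividing by the factor 1 - q of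
  M leaves [g]_q; the remaining 1 - t completes [u+w]_t.\<close>

lemma Qs_scalar_identity:
  assumes "u \<ge> 1" "w \<ge> 1" "w * c - u * b = g"
  shows "1 / M * (q powi e / qint t u * (q powi f / qint t w) *
      (comm_coeff u w * (q powi (u * b) - q powi (w * c)))) =
    qint q g * q powi (e + f + u * b) / qint t (u + w)"
proof -
  have ne: "1 - q powi (- u) \<noteq> 0" "1 - q powi (- w) \<noteq> 0" "1 - q powi (- (u + w)) \<noteq> 0"
    "1 - t \<noteq> 0" "1 - q \<noteq> 0"
    using assms q_powi_neq_1[of "- u"] q_powi_neq_1[of "- w"] q_powi_neq_1[of "- (u + w)"] t_neq_1
    by auto
  have "w * c = u * b + g" using assms(3) by simp
  then have wc: "q powi (w * c) = q powi (u * b) * q powi g" by (simp add: power_int_add)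
  have ef: "q powi (e + f + u * b) = q powi e * q powi f * q powi (u * b)" by (simp add: power_int_add)
  have uw: "u + w \<noteq> 0" using assms by simp
  show ?thesis
    unfolding comm_coeff_alt[OF uw] wc ef qint_t M_def qint_def[of q] using ne
    by (simp add: divide_simps) (simp add: algebra_simps)
qed

text \<open>Both operators in a commutator have coprime indices, so their scalars carry [1]_q = 1,
  and the new factor [k]_q comes from the determinant of the index pairs. The exponent depends only
  on (r,v), hence every admissible (a,b) leads to the same multiple of D. Stating it as 2 e keeps
  the half-integers away and carries the parity through the induction.\<close>

lemma is_Qs_D:
  assumes "is_Qs r v T"
  shows "r \<ge> 1 \<and> v \<ge> 0 \<and> (\<exists>e. 2 * e = (r - 1) * (v - 1) - gcd r v + 1 \<and>
    (\<forall>F\<in>psum_polys. T F = const_sf (qint q (gcd r v) * q powi e / qint t r) * D r v F))"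
  using assms
proof induction
  case (base n)
  then show ?case using t_neq_1 by (auto simp: qint_def intro!: exI[of _ 0])
next
  case (step k m n a b A B)
  let ?K = "k * m" and ?V = "k * n"
  note idx = Qs_indices[OF step.hyps(1-3,5-7)]
  have gcd: "gcd (?K - a) (?V - b) = 1" "gcd a b = 1" "gcd ?K ?V = k"
    using idx step.hyps(1,4) by (simp_all add: coprime_iff_gcd_eq_1[symmetric] gcd_mult_distrib_int[symmetric])
  have q1: "qint q 1 = 1" by (simp add: qint_def)
  obtain e where e: "2 * e = (?K - a - 1) * (?V - b - 1)"
    and A: "\<And>F. F \<in> psum_polys \<Longrightarrow> A F = const_sf (q powi e / qint t (?K - a)) * D (?K - a) (?V - b) F"
    using step.IH(1) unfolding gcd q1 by auto
  obtain f where f: "2 * f = (a - 1) * (b - 1)"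
    and B: "\<And>F. F \<in> psum_polys \<Longrightarrow> B F = const_sf (q powi f / qint t a) * D a b F"
    using step.IH(2) unfolding gcd q1 by auto
  let ?e = "e + f + (?K - a) * b"
  \<comment> \<open>The determinant is k (n a - m b) = k; it plays the role of g in
    \<open>Qs_scalar_identity\<close> and supplies the gcd in the exponent.\<close>
  have k: "a * (?V - b) - (?K - a) * b = k"
    using arg_cong[OF step.hyps(7), of "\<lambda>x. k * x"] by (simp add: algebra_simps)
  have "2 * ?e = (?K - a - 1) * (?V - b - 1) + (a - 1) * (b - 1) + 2 * ((?K - a) * b)"
    using e f by simp
  also have "\<dots> = (?K - 1) * (?V - 1) - (a * (?V - b) - (?K - a) * b) + 1"
    by (simp add: algebra_simps)
  finally have 2: "2 * ?e = (?K - 1) * (?V - 1) - gcd ?K ?V + 1" by (simp only: k gcd)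
  have pos: "?K - a \<ge> 1" "?V - b \<ge> 0" "?K - a + a \<noteq> 0" using step.hyps idx by auto
  have "const_sf (1 / M) * (A (B F) - B (A F)) =
      const_sf (qint q (gcd ?K ?V) * q powi ?e / qint t ?K) * D ?K ?V F" if F: "F \<in> psum_polys" for F
  proof -
    let ?cA = "q powi e / qint t (?K - a)" and ?cB = "q powi f / qint t a"
    let ?DA = "D (?K - a) (?V - b)" and ?DB = "D a b"
    have "A (B F) = const_sf ?cA * (const_sf ?cB * ?DA (?DB F))"
      by (simp only: A B F psum_polys_mult psum_polys_const D_psum_polys D_const_mult)
    moreover have "B (A F) = const_sf ?cB * (const_sf ?cA * ?DB (?DA F))"
      by (simp only: A B F psum_polys_mult psum_polys_const D_psum_polys D_const_mult)
    ultimately have "const_sf (1 / M) * (A (B F) - B (A F)) =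
        const_sf (1 / M) * (const_sf (?cA * ?cB) * (?DA (?DB F) - ?DB (?DA F)))"
      by (simp only: const_sf_mult right_diff_distrib ac_simps)
    also have "\<dots> = const_sf (1 / M * (?cA * ?cB *
        (comm_coeff (?K - a) a * (q powi ((?K - a) * b) - q powi (a * (?V - b)))))) * D ?K ?V F"
      unfolding D_commutator[OF pos(3) F pos(2) idx(2)] const_sf_mult by (simp add: mult.assoc)
    also have "1 / M * (?cA * ?cB * (comm_coeff (?K - a) a * (q powi ((?K - a) * b) - q powi (a * (?V - b))))) =
        qint q k * q powi ?e / qint t (?K - a + a)"
      by (rule Qs_scalar_identity[OF pos(1) step.hyps(5) k])
    finally show ?thesis by (simp add: gcd)
  qed
  moreover have "?K \<ge> 1" "?V \<ge> 0" using step.hyps by auto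
  ultimately show ?case using 2 by blast
qed

section \<open>Elementary symmetric functions of the alphabet X[N]_q\<close>

lemma frob_q_qint_q: "k \<ge> 1 \<Longrightarrow> frob_q k (qint q (int N)) = (q powi (int N - 1)) ^ k * beta (int N) k"
proof -
  assume k: "k \<ge> 1"
  have 1: "frob_q k (qint q (int N)) = (1 - q powi (int N * int k)) / (1 - q powi int k)"
    using k by (simp add: qint_def frob_q_divide frob_q_diff frob_q_1 frob_q_power frob_q_q
        flip: power_mult) (simp add: mult.commute flip: power_mult of_nat_mult)
  have ne: "1 - q powi int k \<noteq> 0" "1 - q powi (- int k) \<noteq> 0"
    using k q_powi_neq_1[of "int k"] q_powi_neq_1[of "- int k"] by auto
  have p: "(q powi (int N - 1)) ^ k = q powi (int N * int k) * q powi (- int k)"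
    by (simp add: q_powi_power power_int_add[symmetric] algebra_simps)
  have i: "q powi (int N * int k) * q powi (- int N * int k) = 1" "q powi int k * q powi (- int k) = 1"
    by (simp_all only: power_int_add[symmetric] q_nonzero simp_thms) simp_all
  \<comment> \<open>With opposite powers of q as independent letters, only x y = 1 and z w = 1 are
    left to use, and the claim becomes polynomial.\<close>
  define x y z w where "x = q powi (int N * int k)" and "y = q powi (- int N * int k)"
    and "z = q powi int k" and "w = q powi (- int k)"
  have xyzw: "x * y = 1" "z * w = 1" "1 - z \<noteq> 0" "1 - w \<noteq> 0"
    using i ne by (simp_all only: x_def y_def z_def w_def not_False_eq_True)
  have "(1 - x) * (1 - w) = x * w * (1 - y) * (1 - z)"
  proof -
    have "x * w * (1 - y) * (1 - z) = x * w - x * (z * w) - (x * y) * w + (x * y) * (z * w)"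
      by (simp add: algebra_simps)
    then show ?thesis unfolding xyzw by (simp add: algebra_simps)
  qed
  then have "(1 - x) / (1 - z) = x * w * ((1 - y) / (1 - w))"
    using xyzw by (simp add: field_simps)
  then show ?thesis by (simp only: 1 p beta_def x_def y_def z_def w_def)
qed

lemma elem_sym_psum_polys: "elem_sym n \<in> psum_polys"
proof -
  have "fps_nth (Abs_fps (\<lambda>n. (-1) ^ n * elem_sym n)) n \<in> psum_polys"
    using newton_elem_sym by (rule newton_psum_polys) (simp add: psum_polys_0 psum_polys_power_sum)
  then have "(-1) ^ n * elem_sym n \<in> psum_polys" by simp
  then have "const_sf ((-1) ^ n) * ((-1) ^ n * elem_sym n) \<in> psum_polys"
    by (rule psum_polys_mult[OF psum_polys_const])
  moreover have "const_sf ((-1) ^ n) * ((-1) ^ n * elem_sym n) = (elem_sym n :: Qq symfun)"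
    by (simp add: const_sf_power const_sf_uminus mult.assoc[symmetric] power_add[symmetric])
  ultimately show ?thesis by (simp only:)
qed

text \<open>The alphabets [N]_q and q^(N-1) [N]_t consist of the same powers of q. Hence the series
  of (-1)^n e_n[X[N]_q] has the Newton recursion of \<open>omega_series\<close> at q^(N-1)
  z.\<close>

lemma pleth_elem_sym:
  "pleth (elem_sym n) (X * cst (qint q (int N))) =
    cst ((-1) ^ n * q powi ((int N - 1) * int n)) * fls_const (fps_nth (omega_series (int N)) n)"
proof -
  let ?E = "X * cst (qint q (int N))"
  let ?c = "cst (q powi (int N - 1))"
  let ?e = "\<lambda>n. (-1) ^ n * elem_sym n :: Qq symfun"
  have m1: "(-1) ^ n = const_sf ((-1) ^ n :: Qq)" for n
    by (simp add: const_sf_power const_sf_uminus)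
  have psum_polys: "?e n \<in> psum_polys" for n
    unfolding m1 by (intro psum_polys_mult psum_polys_const elem_sym_psum_polys)
  have pleth_e: "newton (Abs_fps (\<lambda>k. pleth (fps_nth (Abs_fps (\<lambda>k. if k = 0 then 0 else power_sum k)) k) ?E))
      (Abs_fps (\<lambda>n. pleth (fps_nth (Abs_fps ?e) n) ?E))"
    by (rule newton_pleth[OF newton_elem_sym]) (simp_all add: psum_polys psum_polys_0 psum_polys_power_sum)
  have scaled: "newton (Abs_fps (\<lambda>n. ?c ^ n * fps_nth (Abs_fps (\<lambda>n. fls_const (fps_nth (omega_newton (int N)) n))) n))
      (Abs_fps (\<lambda>n. ?c ^ n * fps_nth (Abs_fps (\<lambda>n. fls_const (fps_nth (omega_series (int N)) n))) n))"
    by (intro newton_scale newton_hom newton_omega_series) (simp_all add: fls_plus_const[symmetric])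
  have B: "Abs_fps (\<lambda>k. pleth (fps_nth (Abs_fps (\<lambda>k. if k = 0 then 0 else power_sum k)) k) ?E) =
      Abs_fps (\<lambda>n. ?c ^ n * fps_nth (Abs_fps (\<lambda>n. fls_const (fps_nth (omega_newton (int N)) n))) n)"
  proof (rule fps_ext)
    fix k
    show "fps_nth (Abs_fps (\<lambda>k. pleth (fps_nth (Abs_fps (\<lambda>k. if k = 0 then 0 else power_sum k)) k) ?E)) k =
        fps_nth (Abs_fps (\<lambda>n. ?c ^ n * fps_nth (Abs_fps (\<lambda>n. fls_const (fps_nth (omega_newton (int N)) n))) n)) k"
    proof (cases "k = 0")
      case True
      then show ?thesis using pleth_const[of 0] by (simp add: omega_newton_def)
    next
      case False
      then have k: "k \<ge> 1" by simp
      have "pleth (power_sum k) ?E = fls_const (const_sf ((q powi (int N - 1)) ^ k * beta (int N) k) * power_sum k)"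
        by (simp only: pleth_power_sum[OF k] power_sum_pleth_X_cst[OF k] frob_q_qint_q[OF k])
      also have "\<dots> = ?c ^ k * fls_const (fps_nth (omega_newton (int N)) k)"
        using False by (simp add: omega_newton_def const_sf_mult const_sf_power mult.assoc flip: fls_const_power)
      finally show ?thesis using False by simp
    qed
  qed
  have "Abs_fps (\<lambda>n. pleth (fps_nth (Abs_fps ?e) n) ?E) =
      Abs_fps (\<lambda>n. ?c ^ n * fps_nth (Abs_fps (\<lambda>n. fls_const (fps_nth (omega_series (int N)) n))) n)"
    by (rule newton_unique[OF pleth_e[unfolded B] scaled inverse_of_nat_fls])
  then have *: "pleth (?e n) ?E = ?c ^ n * fls_const (fps_nth (omega_series (int N)) n)"
    by (simp add: fps_eq_iff)
  have "elem_sym n = const_sf ((-1) ^ n) * ?e n"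
    by (simp add: m1[symmetric] mult.assoc[symmetric] power_add[symmetric])
  then have "pleth (elem_sym n) ?E = pleth (const_sf ((-1) ^ n) * ?e n) ?E" by (simp only:)
  also have "\<dots> = cst ((-1) ^ n) * (?c ^ n * fls_const (fps_nth (omega_series (int N)) n))"
    by (simp only: pleth_mult[OF psum_polys_const psum_polys] pleth_const *)
  also have "\<dots> = cst ((-1) ^ n * q powi ((int N - 1) * int n)) * fls_const (fps_nth (omega_series (int N)) n)"
    by (simp only: const_sf_mult fls_const_power[symmetric] const_sf_power[symmetric] q_powi_power
        fls_const_mult_const mult.assoc)
  finally show ?thesis .
qed

lemma qint_q_eq:
  assumes "N \<ge> 1"
  shows "qint q N = q powi (N - 1) * qint t N"
proof -
  have "1 - t = (q - 1) / q" by (simp add: t_def field_simps)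
  then have "q powi (N - 1) * qint t N = q powi (N - 1) * q * (1 - q powi (- N)) / (q - 1)"
    by (simp add: qint_t)
  also have "q powi (N - 1) * q = q powi N" by (simp add: power_int_diff)
  also have "q powi N * (1 - q powi (- N)) = q powi N - 1"
    by (simp add: right_diff_distrib power_int_minus)
  also have "(q powi N - 1) / (q - 1) = qint q N"
    unfolding qint_def by (metis minus_diff_eq minus_divide_divide)
  finally show ?thesis by simp
qed

theorem theoremI3:
  fixes m n k :: nat and T :: "Qq symfun \<Rightarrow> Qq symfun"
  assumes "m \<ge> 1" "n \<ge> 1" "coprime m n" "k \<ge> 1"
    and "is_Qs (int (k * m)) (int (k * n)) T"
  shows "cst (q ^ (((k * m - 1) * (k * n - 1) + (k - 1)) div 2)) * fls_const (T ((-1) ^ (k * n))) =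
         cst (qint q (int k) / qint q (int (k * m))) *
           pleth (elem_sym (k * n)) (X * cst (qint q (int (k * m))))"
proof -
  define N V where "N = k * m" and "V = k * n"
  have N: "N \<ge> 1" and V: "V \<ge> 1" using assms by (simp_all add: N_def V_def)
  have "gcd N V = k" using assms(3) by (simp add: N_def V_def gcd_mult_distrib_nat[symmetric])
  then have gcd: "gcd (int N) (int V) = int k" by simp
  from is_Qs_D[OF assms(5)] obtain e where e: "2 * e = (int N - 1) * (int V - 1) - int k + 1"
    and T: "\<And>F. F \<in> psum_polys \<Longrightarrow> T F = const_sf (qint q (int k) * q powi e / qint t (int N)) * D (int N) (int V) F"
    by (auto simp only: N_def[symmetric] V_def[symmetric] gcd)
  define E where "E = ((N - 1) * (V - 1) + (k - 1)) div 2"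
  have "2 * E = (N - 1) * (V - 1) + (k - 1)"
    using Qs_exponent_even[OF assms(4,1,2,3)] by (simp add: E_def N_def V_def)
  then have "2 * int E = int ((N - 1) * (V - 1) + (k - 1))" by linarith
  also have "\<dots> = (int N - 1) * (int V - 1) + (int k - 1)"
    using N V assms(4) by (simp add: of_nat_diff)
  \<comment> \<open>The terms (k - 1)/2 of the two exponents cancel. Of the total (N - 1) (V - 1),
    the part (N - 1) V is the scaling in \<open>pleth_elem_sym\<close>, and - (N - 1) converts [N]_t
    into [N]_q.\<close>
  finally have "2 * (int E + e) = 2 * ((int N - 1) * int V - (int N - 1))"
    using e by (simp add: algebra_simps)
  then have Ee: "int E + e = (int N - 1) * int V - (int N - 1)" by simp
  let ?h = "fps_nth (omega_series (int N)) V"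
  have m1: "(-1) ^ V = const_sf ((-1) ^ V :: Qq)"
    by (simp add: const_sf_power const_sf_uminus)
  have scalar: "q ^ E * (qint q (int k) * q powi e / qint t (int N)) =
      qint q (int k) / qint q (int N) * q powi ((int N - 1) * int V)"
  proof -
    have "q ^ E * q powi e = q powi ((int N - 1) * int V) / q powi (int N - 1)"
      by (simp add: power_int_add[symmetric] power_int_diff[symmetric] Ee flip: power_int_of_nat)
    then have "q ^ E * q powi e / qint t (int N) =
        q powi ((int N - 1) * int V) / qint q (int N)"
      using N by (simp add: qint_q_eq)
    then have "qint q (int k) * (q ^ E * q powi e / qint t (int N)) =
        qint q (int k) * (q powi ((int N - 1) * int V) / qint q (int N))" by (simp only:)
    then show ?thesis by (simp add: ac_simps)
  qed
  \<comment> \<open>The constant argument provides the sign (-1)^V that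
    \<open>pleth_elem_sym\<close> carries on the other side.\<close>
  have "T ((-1) ^ V) = const_sf (qint q (int k) * q powi e / qint t (int N)) * (const_sf ((-1) ^ V) * ?h)"
    unfolding m1 T[OF psum_polys_const] by (simp add: D_const)
  then have "cst (q ^ E) * fls_const (T ((-1) ^ V)) =
      cst (q ^ E * (qint q (int k) * q powi e / qint t (int N)) * (-1) ^ V) * fls_const ?h"
    by (simp only: fls_const_mult_const const_sf_mult mult.assoc)
  also have "\<dots> = cst (qint q (int k) / qint q (int N)) *
      (cst ((-1) ^ V * q powi ((int N - 1) * int V)) * fls_const ?h)"
    unfolding scalar by (simp only: fls_const_mult_const const_sf_mult ac_simps)
  finally show ?thesis
    unfolding pleth_elem_sym N_def[symmetric] V_def[symmetric] E_def[symmetric] .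
qed

end
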